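(* Let $F:\mathbb{S}^1\to\mathbb{S}^1$ be a critical circle map with irrational rotation number $\theta=[a_1,a_2,\dots]\in(0,1)$, let $h:\mathbb{R}\to\mathbb{R}$ be the lift of the normalized linearizing map, and for $n\ge1$ let $h_n:\mathbb{R}\to\mathbb{R}$ be the piecewise affine approximation of $h$ at level $n$. Then there are constants $C\ge1$ and $n_0\ge1$ such that for all $n\ge n_0$ $$\max_{1\le m\le n}a_m\le C\,\|h_n\|_{qs}.$$
   Context: A critical circle map is an orientation-preserving real-analytic homeomorphism $F$ of the unit circle $\mathbb{S}^1$ with exactly one critical point, normalized to be $1$. Its rotation number is $\theta=[a_1,a_2,\dots]=\frac{1}{a_1+\frac{1}{a_2+\cdots}}$, with $p_n/q_n=[a_1,\dots,a_n]$ in lowest terms. The lift $f$ is the increasing homeomorphism of $\mathbb{R}$ with $e^{2\pi if(x)}=F(e^{2\pi ix})$ and $\lim_n(f^n(x)-x)/n=\theta$. $h$ is the unique increasing homeomorphism of $\mathbb{R}$ with $h(0)=0$, $h(x+1)=h(x)+1$ and $h(f(x))=h(x)+\theta$ (it exists by a theorem of Yoccoz). $\mathcal{Q}_n=\{f^{-j}(0)+m:0\le j<q_n,\ m\in\mathbb{Z}\}$. The map $h_n$ satisfies $h_n(x)=h(x)$ for $x\in\mathcal{Q}_n$ and is affine between adjacent points of $\mathcal{Q}_n$. For an increasing homeomorphism $g:\mathbb{R}\to\mathbb{R}$, $\|g\|_{qs}$ is the smallest $K\ge1$ (possibly $\infty$) such that $\frac1K\le\frac{g(x+t)-g(x)}{g(x)-g(x-t)}\le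 K$ for all $x\in\mathbb{R}$, $t>0$. *)

theory Defs
  imports "HOL-Analysis.Analysis"
begin

definition incr_homeo :: "(real \<Rightarrow> real) \<Rightarrow> bool" where
  "incr_homeo g \<longleftrightarrow> strict_mono g \<and> (\<exists>g'. homeomorphism UNIV UNIV g g')"

definition circle_lift :: "(complex \<Rightarrow> complex) \<Rightarrow> (real \<Rightarrow> real) \<Rightarrow> bool" where
  "circle_lift F f \<longleftrightarrow> incr_homeo f \<and> (\<forall>x. cis (2 * pi * f x) = F (cis (2 * pi * x)))"

definition real_analytic :: "(real \<Rightarrow> real) \<Rightarrow> bool" where
  "real_analytic f \<longleftrightarrow> (\<forall>x. \<exists>P. (\<lambda>t. f (x + t)) has_fps_expansion P)"

text \<open>
  A circle map is a function on the complex plane of which only the values on the unit circle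
  matter. A homeomorphism of the circle preserves orientation iff it has an increasing lift.
  Analyticity and critical points are expressed in the angular coordinate, that is, through a lift;
  since two lifts differ by an integer constant, the choice of the lift is irrelevant.
\<close>
definition critical_circle_map :: "(complex \<Rightarrow> complex) \<Rightarrow> bool" where
  "critical_circle_map F \<longleftrightarrow>
     (\<exists>G. homeomorphism (sphere 0 1) (sphere 0 1) F G) \<and>
     (\<exists>f. circle_lift F f \<and> real_analytic f \<and>
        {cis (2 * pi * x) | x. (f has_real_derivative 0) (at x)} = {1})"

text \<open>
  The rotation number of a circle map is only defined modulo 1; the representative \<open>\<theta>\<close> singles
  out one lift.
\<close>
definition lift_with_rotation_number ::
    "(complex \<Rightarrow> complex) \<Rightarrow> real \<Rightarrow> (real \<Rightarrow> real) \<Rightarrow> bool" where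
  "lift_with_rotation_number F \<theta> f \<longleftrightarrow>
     circle_lift F f \<and> (\<forall>x. (\<lambda>n. ((f ^^ n) x - x) / real n) \<longlonglongrightarrow> \<theta>)"

definition normalized_linearization :: "(real \<Rightarrow> real) \<Rightarrow> real \<Rightarrow> (real \<Rightarrow> real) \<Rightarrow> bool" where
  "normalized_linearization f \<theta> h \<longleftrightarrow>
     incr_homeo h \<and> h 0 = 0 \<and> (\<forall>x. h (x + 1) = h x + 1) \<and> (\<forall>x. h (f x) = h x + \<theta>)"

fun cf_value :: "nat list \<Rightarrow> rat" where
  "cf_value [] = 0"
| "cf_value (k # ks) = 1 / (of_nat k + cf_value ks)"

text \<open>Partial quotients are indexed from 1; the value \<open>a 0\<close> is never used.\<close>
definition cf_convergent :: "(nat \<Rightarrow> nat) \<Rightarrow> nat \<Rightarrow> rat" where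
  "cf_convergent a n = cf_value (map a [1..<Suc n])"

definition cf_expansion :: "real \<Rightarrow> (nat \<Rightarrow> nat) \<Rightarrow> bool" where
  "cf_expansion \<theta> a \<longleftrightarrow>
     (\<forall>m\<ge>1. a m \<ge> 1) \<and> (\<lambda>n. real_of_rat (cf_convergent a n)) \<longlonglongrightarrow> \<theta>"

definition cf_denom :: "(nat \<Rightarrow> nat) \<Rightarrow> nat \<Rightarrow> nat" where
  "cf_denom a n = nat (snd (quotient_of (cf_convergent a n)))"

definition dyn_partition :: "(real \<Rightarrow> real) \<Rightarrow> (nat \<Rightarrow> nat) \<Rightarrow> nat \<Rightarrow> real set" where
  "dyn_partition f a n = {(inv f ^^ j) 0 + of_int m | j m. j < cf_denom a n}"

definition pw_affine_interpolant ::
    "real set \<Rightarrow> (real \<Rightarrow> real) \<Rightarrow> (real \<Rightarrow> real) \<Rightarrow> bool" where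
  "pw_affine_interpolant Q h g \<longleftrightarrow>
     (\<forall>x\<in>Q. g x = h x) \<and>
     (\<forall>u\<in>Q. \<forall>v\<in>Q. u < v \<and> {u<..<v} \<inter> Q = {} \<longrightarrow>
        (\<exists>c d. \<forall>x\<in>{u..v}. g x = c * x + d))"

text \<open>The infimum over the empty set is \<open>\<infinity>\<close>.\<close>
definition qs_norm :: "(real \<Rightarrow> real) \<Rightarrow> ereal" where
  "qs_norm g =
     (INF K\<in>{K::real. 1 \<le> K \<and>
        (\<forall>x t. 0 < t \<longrightarrow>
           1 / K \<le> (g (x + t) - g x) / (g x - g (x - t)) \<and>
           (g (x + t) - g x) / (g x - g (x - t)) \<le> K)}. ereal K)"

end

theory Submission
  imports Defs
begin

text \<open>
  Let \<open>q = q\<^sub>m\<^sub>-\<^sub>1\<close>, \<open>p = p\<^sub>m\<^sub>-\<^sub>1\<close>, \<open>A = a\<^sub>m\<close> and \<open>d = \<bar>q \<theta> - p\<bar>\<close>. The points \<open>y\<^sub>k = f\<^sup>-\<^sup>k\<^sup>q(0) + k p\<close> with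
  \<open>0 \<le> k \<le> A\<close> are consecutive in the linearizing coordinate, at distance \<open>d\<close>, and belong to the
  partition of every level \<open>n \<ge> m\<close>. Suppose that they lie to the right of
  \<open>0\<close> (otherwise reflect the line), and put \<open>Y = y\<^sub>A\<close>. The
  intervals \<open>f\<^sup>i([0, Y])\<close>, \<open>1 \<le> i < q\<close>, are disjoint modulo 1, avoid the critical point and are short if
  \<open>m\<close> is large, so \<open>f\<^sup>q\<^sup>-\<^sup>1\<close> decreases cross-ratios of points of \<open>f([0, Y])\<close> at most by a factor close
  to 1, whereas the first iterate increases those of points of \<open>[0, Y]\<close> by a definite amount, because
  the Schwarzian derivative of \<open>f\<close> near its critical point is below the one of \<open>t\<^sup>2\<close>. Hence
  \<open>R = f\<^sup>q - p\<close> cannot be nearly the identity at two points of \<open>[Y/8, Y]\<close> at distance \<open>Y/8\<close> or more: all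
  but boundedly many of the points \<open>y\<^sub>k\<close> in \<open>[Y/8, Y]\<close> lie in one interval of length \<open>Y/8\<close>. No a priori
  bounds on the geometry of the orbit are needed to conclude: in every case there are two adjacent
  intervals of equal length such that one carries a fixed proportion of the \<open>A\<close> points and the other
  boundedly many of them.
\<close>

section \<open>Cross-ratios and Schwarzian derivatives\<close>

text \<open>The middle gap times the whole interval, over the product of the outer gaps. Moebius
  maps preserve it and a smaller Schwarzian derivative makes it grow more, so bounds on Schwarzian
  derivatives become bounds on lengths.\<close>

definition cross_ratio :: "real \<Rightarrow> real \<Rightarrow> real \<Rightarrow> real \<Rightarrow> real" where
  "cross_ratio x a y b = (y - a) * (b - x) / ((a - x) * (b - y))"

lemma cross_ratio_pos:
  assumes "x < a" "a < y" "y < b"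
  shows "cross_ratio x a y b > 0"
  using assms by (simp add: cross_ratio_def)

text \<open>Here \<open>\<psi>\<close> and \<open>\<phi>\<close> are \<open>(f')\<^sup>-\<^sup>1\<^sup>/\<^sup>2\<close> and \<open>(k')\<^sup>-\<^sup>1\<^sup>/\<^sup>2\<close>, and the condition on them says that the
  Schwarzian derivative of \<open>f\<close> is at most the one of \<open>k\<close>. If \<open>f y < k y\<close>, the quotient \<open>\<psi>/\<phi>\<close> would
  have an interior maximum, against the monotonicity of the Wronskian.\<close>
lemma le_at_fourth_point:
  fixes f k \<psi> \<phi> :: "real \<Rightarrow> real"
  assumes ord: "x < a" "a < y" "y < b"
    and f: "\<And>t. \<lbrakk>x \<le> t; t \<le> b\<rbrakk> \<Longrightarrow> (f has_real_derivative 1 / (\<psi> t)\<^sup>2) (at t)"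
    and k: "\<And>t. \<lbrakk>x \<le> t; t \<le> b\<rbrakk> \<Longrightarrow> (k has_real_derivative 1 / (\<phi> t)\<^sup>2) (at t)"
    and \<psi>: "\<And>t. \<lbrakk>x \<le> t; t \<le> b\<rbrakk> \<Longrightarrow> (\<psi> has_real_derivative \<psi>' t) (at t)"
    and \<psi>': "\<And>t. \<lbrakk>x \<le> t; t \<le> b\<rbrakk> \<Longrightarrow> (\<psi>' has_real_derivative \<psi>'' t) (at t)"
    and \<phi>: "\<And>t. \<lbrakk>x \<le> t; t \<le> b\<rbrakk> \<Longrightarrow> (\<phi> has_real_derivative \<phi>' t) (at t)"
    and \<phi>': "\<And>t. \<lbrakk>x \<le> t; t \<le> b\<rbrakk> \<Longrightarrow> (\<phi>' has_real_derivative \<phi>'' t) (at t)"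
    and pos: "\<And>t. \<lbrakk>x \<le> t; t \<le> b\<rbrakk> \<Longrightarrow> \<psi> t > 0" "\<And>t. \<lbrakk>x \<le> t; t \<le> b\<rbrakk> \<Longrightarrow> \<phi> t > 0"
    and conv: "\<And>t. \<lbrakk>x \<le> t; t \<le> b\<rbrakk> \<Longrightarrow> \<psi> t * \<phi>'' t \<le> \<phi> t * \<psi>'' t"
    and eq: "f x = k x" "f a = k a" "f b = k b"
  shows "k y \<le> f y"
proof (rule ccontr)
  assume "\<not> k y \<le> f y"
  hence lt: "f y < k y" by simp
  define \<Delta> where "\<Delta> t = f t - k t" for t
  have D: "(\<Delta> has_real_derivative 1 / (\<psi> t)\<^sup>2 - 1 / (\<phi> t)\<^sup>2) (at t)" if "x \<le> t" "t \<le> b" for t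
    unfolding \<Delta>_def using f[OF that] k[OF that] by (rule DERIV_diff)
  \<comment> \<open>\<open>\<Delta>\<close> vanishes at \<open>x\<close>, \<open>a\<close> and
    \<open>b\<close> and is negative at \<open>y\<close>. The mean value theorem yields
    \<open>s1 < s2 < s3\<close> at which \<open>\<psi> / \<phi>\<close> is equal to 1, above 1 and
    below 1.\<close>
  obtain s1 where s1: "x < s1" "s1 < a" "1 / (\<psi> s1)\<^sup>2 - 1 / (\<phi> s1)\<^sup>2 = 0"
    using MVT2[of x a \<Delta> "\<lambda>t. 1 / (\<psi> t)\<^sup>2 - 1 / (\<phi> t)\<^sup>2"] D ord eq
    by (auto simp: \<Delta>_def)
  obtain s2 where s2: "a < s2" "s2 < y" "\<Delta> y - \<Delta> a = (y - a) * (1 / (\<psi> s2)\<^sup>2 - 1 / (\<phi> s2)\<^sup>2)"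
    using MVT2[of a y \<Delta> "\<lambda>t. 1 / (\<psi> t)\<^sup>2 - 1 / (\<phi> t)\<^sup>2"] D ord by auto
  obtain s3 where s3: "y < s3" "s3 < b" "\<Delta> b - \<Delta> y = (b - y) * (1 / (\<psi> s3)\<^sup>2 - 1 / (\<phi> s3)\<^sup>2)"
    using MVT2[of y b \<Delta> "\<lambda>t. 1 / (\<psi> t)\<^sup>2 - 1 / (\<phi> t)\<^sup>2"] D ord by auto
  have sgn: "1 / (\<psi> t)\<^sup>2 - 1 / (\<phi> t)\<^sup>2 < 0 \<longleftrightarrow> \<phi> t < \<psi> t"
            "1 / (\<psi> t)\<^sup>2 - 1 / (\<phi> t)\<^sup>2 > 0 \<longleftrightarrow> \<psi> t < \<phi> t"
            "1 / (\<psi> t)\<^sup>2 - 1 / (\<phi> t)\<^sup>2 = 0 \<longleftrightarrow> \<psi> t = \<phi> t" if "x \<le> t" "t \<le> b" for t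
    using pos[OF that]
    by (auto simp: divide_simps mult_le_0_iff power2_eq_iff_nonneg power_mono_iff not_le[symmetric])
  have e1: "\<psi> s1 = \<phi> s1" using sgn(3)[of s1] s1 ord by auto
  have "(y - a) * (1 / (\<psi> s2)\<^sup>2 - 1 / (\<phi> s2)\<^sup>2) < 0"
    using s2(3) lt eq by (simp add: \<Delta>_def)
  hence e2: "\<phi> s2 < \<psi> s2" using sgn(1)[of s2] s2 ord by (auto simp: mult_less_0_iff)
  have "(b - y) * (1 / (\<psi> s3)\<^sup>2 - 1 / (\<phi> s3)\<^sup>2) > 0"
    using s3(3) lt eq by (simp add: \<Delta>_def)
  hence e3: "\<psi> s3 < \<phi> s3" using sgn(2)[of s3] s3 ord by (auto simp: zero_less_mult_iff)
  \<comment> \<open>The derivative of \<open>\<rho>\<close> has the sign of the Wronskian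
    \<open>w\<close>, which \<open>conv\<close> makes nondecreasing, so \<open>\<rho>\<close> cannot
    rise first and fall later.\<close>
  define w where "w t = \<phi> t * \<psi>' t - \<psi> t * \<phi>' t" for t
  define \<rho> where "\<rho> t = \<psi> t / \<phi> t" for t
  have D\<rho>: "(\<rho> has_real_derivative w t / (\<phi> t)\<^sup>2) (at t)" if "x \<le> t" "t \<le> b" for t
    unfolding \<rho>_def w_def
    by (rule derivative_eq_intros \<psi>[OF that] \<phi>[OF that] | use pos[OF that] in force)+
       (simp add: power2_eq_square algebra_simps)
  have Dw: "(w has_real_derivative \<phi> t * \<psi>'' t - \<psi> t * \<phi>'' t) (at t)" if "x \<le> t" "t \<le> b" for t
    unfolding w_def
    using DERIV_diff[OF DERIV_mult[OF \<phi>[OF that] \<psi>'[OF that]] DERIV_mult[OF \<psi>[OF that] \<phi>'[OF that]]]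
    by (simp add: algebra_simps)
  obtain r1 where r1: "s1 < r1" "r1 < s2" "\<rho> s2 - \<rho> s1 = (s2 - s1) * (w r1 / (\<phi> r1)\<^sup>2)"
    using MVT2[of s1 s2 \<rho> "\<lambda>t. w t / (\<phi> t)\<^sup>2"] D\<rho> s1 s2 ord by force
  obtain r2 where r2: "s2 < r2" "r2 < s3" "\<rho> s3 - \<rho> s2 = (s3 - s2) * (w r2 / (\<phi> r2)\<^sup>2)"
    using MVT2[of s2 s3 \<rho> "\<lambda>t. w t / (\<phi> t)\<^sup>2"] D\<rho> s3 s2 s1 ord by force
  have "\<rho> s1 = 1" "\<rho> s2 > 1" "\<rho> s3 < 1"
    using e1 e2 e3 pos(2)[of s1] pos(2)[of s2] pos(2)[of s3] s1 s2 s3 ord by (auto simp: \<rho>_def)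
  hence "(s2 - s1) * (w r1 / (\<phi> r1)\<^sup>2) > 0" "(s3 - s2) * (w r2 / (\<phi> r2)\<^sup>2) < 0"
    using r1 r2 by linarith+
  hence "w r1 > 0" "w r2 < 0" using s1 s2 s3
    by (auto simp: zero_less_mult_iff mult_less_0_iff zero_less_divide_iff divide_less_0_iff)
  moreover have "w r1 \<le> w r2"
  proof (rule DERIV_nonneg_imp_nondecreasing[of r1 r2 w])
    show "r1 \<le> r2" using r1 r2 by linarith
    fix t assume "r1 \<le> t" "t \<le> r2"
    hence "x \<le> t" "t \<le> b" using r1 r2 s1 s2 s3 ord by auto
    thus "\<exists>z. (w has_real_derivative z) (at t) \<and> 0 \<le> z" using Dw conv by (meson diff_ge_0_iff_ge)
  qed
  ultimately show False by linarith
qed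

text \<open>The Moebius map \<open>w \<mapsto> w / (A + C w)\<close> leaves cross-ratios and Schwarzian derivatives unchanged; it is
  chosen such that its composition with \<open>f\<close> agrees with \<open>k\<close> at \<open>x\<close>, \<open>a\<close> and \<open>b\<close>.\<close>
lemma cross_ratio_compare_aux:
  fixes f k \<psi> \<phi> :: "real \<Rightarrow> real"
  assumes ord: "x < a" "a < y" "y < b"
    and f: "\<And>t. \<lbrakk>x \<le> t; t \<le> b\<rbrakk> \<Longrightarrow> (f has_real_derivative 1 / (\<psi> t)\<^sup>2) (at t)"
    and k: "\<And>t. \<lbrakk>x \<le> t; t \<le> b\<rbrakk> \<Longrightarrow> (k has_real_derivative 1 / (\<phi> t)\<^sup>2) (at t)"
    and \<psi>: "\<And>t. \<lbrakk>x \<le> t; t \<le> b\<rbrakk> \<Longrightarrow> (\<psi> has_real_derivative \<psi>' t) (at t)"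
    and \<psi>': "\<And>t. \<lbrakk>x \<le> t; t \<le> b\<rbrakk> \<Longrightarrow> (\<psi>' has_real_derivative \<psi>'' t) (at t)"
    and \<phi>: "\<And>t. \<lbrakk>x \<le> t; t \<le> b\<rbrakk> \<Longrightarrow> (\<phi> has_real_derivative \<phi>' t) (at t)"
    and \<phi>': "\<And>t. \<lbrakk>x \<le> t; t \<le> b\<rbrakk> \<Longrightarrow> (\<phi>' has_real_derivative \<phi>'' t) (at t)"
    and pos: "\<And>t. \<lbrakk>x \<le> t; t \<le> b\<rbrakk> \<Longrightarrow> \<psi> t > 0" "\<And>t. \<lbrakk>x \<le> t; t \<le> b\<rbrakk> \<Longrightarrow> \<phi> t > 0"
    and conv: "\<And>t. \<lbrakk>x \<le> t; t \<le> b\<rbrakk> \<Longrightarrow> \<psi> t * \<phi>'' t \<le> \<phi> t * \<psi>'' t"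
    and zero: "f a = 0" "k a = 0"
  shows "cross_ratio (k x) (k a) (k y) (k b) \<le> cross_ratio (f x) (f a) (f y) (f b)"
proof -
  have fmono: "f s < f t" if "x \<le> s" "s < t" "t \<le> b" for s t
    using that by (intro DERIV_pos_imp_increasing[OF that(2)])
      (metis f order_trans less_imp_le pos(1) zero_less_power zero_less_divide_1_iff)
  have kmono: "k s < k t" if "x \<le> s" "s < t" "t \<le> b" for s t
    using that by (intro DERIV_pos_imp_increasing[OF that(2)])
      (metis k order_trans less_imp_le pos(2) zero_less_power zero_less_divide_1_iff)
  have fo: "f x < 0" "0 < f y" "f y < f b" and ko: "k x < 0" "0 < k y" "k y < k b"
    using fmono[of x a] fmono[of a y] fmono[of y b] kmono[of x a] kmono[of a y] kmono[of y b] ord zero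
    by auto
  have fb: "f b > 0" and kb: "k b > 0" using fo ko by auto
  \<comment> \<open>For the map \<open>F\<close> below, \<open>1 / F = A / f + C\<close>, so
    \<open>A\<close> and \<open>C\<close> solve the linear equations \<open>F x = k x\<close> and
    \<open>F b = k b\<close>; at \<open>a\<close> both sides are 0.\<close>
  define A where "A = (1 / k b - 1 / k x) / (1 / f b - 1 / f x)"
  define C where "C = 1 / k b - A / f b"
  have i: "1 / f b - 1 / f x > 0" "1 / k b - 1 / k x > 0"
    using fo ko by (smt (verit) divide_neg_pos zero_less_divide_iff)+
  have A: "A > 0" unfolding A_def using i by simp
  have Ci: "C = 1 / k x - A / f x"
  proof -
    have "A * (1 / f b - 1 / f x) = 1 / k b - 1 / k x" unfolding A_def using i by (intro nonzero_eq_divide_eq[THEN iffD1]) auto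
    thus ?thesis by (simp add: C_def algebra_simps)
  qed
  have Ab: "A + C * f b = f b / k b" unfolding C_def using fb by (simp add: field_simps)
  have Ax: "A + C * f x = f x / k x" unfolding Ci using fo by (simp add: field_simps)
  \<comment> \<open>The denominator is affine in \<open>f\<close> and positive at both ends of the
    interval, so \<open>F\<close> has no pole there.\<close>
  have den: "A + C * f t > 0" if "x \<le> t" "t \<le> b" for t
  proof (cases "C \<ge> 0")
    case True
    have "f x \<le> f t" using fmono[of x t] that by (cases "t = x") auto
    hence "A + C * f x \<le> A + C * f t" using True by (simp add: mult_left_mono)
    thus ?thesis using Ax fo ko by (smt (verit) divide_neg_neg)
  next
    case False
    have "f t \<le> f b" using fmono[of t b] that by (cases "t = b") auto
    hence "A + C * f b \<le> A + C * f t" using False by (simp add: mult_left_mono_neg)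
    thus ?thesis using Ab fb kb by (smt (verit) divide_pos_pos)
  qed
  define F where "F t = f t / (A + C * f t)" for t
  define c where "c = 1 / sqrt A"
  have c: "c > 0" "c * c * A = 1" using A by (auto simp: c_def)
  \<comment> \<open>\<open>\<Psi>\<close> is the inverse square root of \<open>F'\<close>. In its
    second derivative the terms with \<open>C\<close> cancel, so
    \<open>\<Psi>'' / \<Psi> = \<psi>'' / \<psi>\<close>: this is the invariance of the Schwarzian
    derivative.\<close>
  define \<Psi> where "\<Psi> t = c * (\<psi> t * (A + C * f t))" for t
  define \<Psi>' where "\<Psi>' t = c * (\<psi>' t * (A + C * f t) + C / \<psi> t)" for t
  define \<Psi>'' where "\<Psi>'' t = c * (\<psi>'' t * (A + C * f t))" for t
  have "k y \<le> F y"
  proof (rule le_at_fourth_point[OF ord, where \<psi> = \<Psi> and \<psi>' = \<Psi>' and \<psi>'' = \<Psi>''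
          and \<phi> = \<phi> and \<phi>' = \<phi>' and \<phi>'' = \<phi>''])
    fix t assume t: "x \<le> t" "t \<le> b"
    note d = den[OF t] and p = pos(1)[OF t]
    define D where "D = 1 / (\<psi> t)\<^sup>2"
    have "(F has_real_derivative A * D / (A + C * f t)\<^sup>2) (at t)"
      unfolding F_def
      by (rule derivative_eq_intros f[OF t, folded D_def] | use d in force)+
         (simp add: power2_eq_square algebra_simps)
    hence "(F has_real_derivative A * (1 / (\<psi> t)\<^sup>2) / (A + C * f t)\<^sup>2) (at t)"
      by (simp only: D_def)
    moreover have "A * (1 / (\<psi> t)\<^sup>2) / (A + C * f t)\<^sup>2 = 1 / (\<Psi> t)\<^sup>2"
      using c d p by (simp add: \<Psi>_def divide_simps power2_eq_square mult.assoc mult.left_commute)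
    ultimately show "(F has_real_derivative 1 / (\<Psi> t)\<^sup>2) (at t)" by simp
    show "(k has_real_derivative 1 / (\<phi> t)\<^sup>2) (at t)" by (rule k[OF t])
    have lin: "((\<lambda>t. A + C * f t) has_real_derivative C * (1 / (\<psi> t)\<^sup>2)) (at t)"
      using DERIV_add[OF DERIV_const DERIV_cmult[OF f[OF t]]] by simp
    have "((\<lambda>t. \<psi> t * (A + C * f t)) has_real_derivative \<psi>' t * (A + C * f t) + C / \<psi> t) (at t)"
      using DERIV_mult[OF \<psi>[OF t] lin] p by (simp add: power2_eq_square)
    thus "(\<Psi> has_real_derivative \<Psi>' t) (at t)"
      unfolding \<Psi>_def \<Psi>'_def by (rule DERIV_cmult)
    have "((\<lambda>t. \<psi>' t * (A + C * f t) + C / \<psi> t) has_real_derivative \<psi>'' t * (A + C * f t)) (at t)"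
      using DERIV_add[OF DERIV_mult[OF \<psi>'[OF t] lin] DERIV_divide[OF DERIV_const[of C] \<psi>[OF t]]] p
      by (simp add: power2_eq_square)
    thus "(\<Psi>' has_real_derivative \<Psi>'' t) (at t)"
      unfolding \<Psi>'_def \<Psi>''_def by (rule DERIV_cmult)
    show "(\<phi> has_real_derivative \<phi>' t) (at t)" "(\<phi>' has_real_derivative \<phi>'' t) (at t)"
      by (rule \<phi>[OF t] \<phi>'[OF t])+
    show "0 < \<Psi> t" "0 < \<phi> t" using pos[OF t] d c by (auto simp: \<Psi>_def)
    have "(\<psi> t * \<phi>'' t) * (c * (A + C * f t)) \<le> (\<phi> t * \<psi>'' t) * (c * (A + C * f t))"
      using conv[OF t] d c by (intro mult_right_mono) auto
    thus "\<Psi> t * \<phi>'' t \<le> \<phi> t * \<Psi>'' t" by (simp add: \<Psi>_def \<Psi>''_def algebra_simps)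
  next
    show "F x = k x" unfolding F_def Ax using fo ko by simp
    show "F b = k b" unfolding F_def Ab using fb kb by simp
    show "F a = k a" unfolding F_def using zero by simp
  qed
  \<comment> \<open>In reciprocals the normalization is affine, so \<open>C\<close> drops out of
    differences; with the second point at 0, cross-ratios are quotients of such differences.\<close>
  hence "1 / F y \<le> 1 / k y" using ko by (intro divide_left_mono) auto
  hence le: "A * (1 / f y - 1 / f b) \<le> 1 / k y - 1 / k b"
    using fo fb by (simp add: F_def C_def field_simps)
  have prod: "(1 / k b - 1 / k x) * (1 / f y - 1 / f b) \<le> (1 / k y - 1 / k b) * (1 / f b - 1 / f x)"
  proof -
    have "A * (1 / f b - 1 / f x) = 1 / k b - 1 / k x"
      unfolding A_def using i by (intro nonzero_eq_divide_eq[THEN iffD1]) auto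
    thus ?thesis
      using mult_right_mono[OF le, of "1 / f b - 1 / f x"] i by (metis less_imp_le mult.commute mult.left_commute)
  qed
  have *: "(1 / k b - 1 / k x) / (1 / k y - 1 / k b) \<le> (1 / f b - 1 / f x) / (1 / f y - 1 / f b)"
  proof -
    have "p / w \<le> r / v" if "p * v \<le> w * r" "v > 0" "w > 0" for p v w r :: real
      using that by (simp add: divide_simps mult.commute)
    moreover have "1 / f y - 1 / f b > 0" "1 / k y - 1 / k b > 0"
      using fo ko by (simp_all add: frac_less2)
    ultimately show ?thesis using prod by blast
  qed
  have cr: "cross_ratio X 0 Y B = (1 / B - 1 / X) / (1 / Y - 1 / B)"
    if "X < 0" "0 < Y" "Y < B" for X Y B :: real
    using that by (simp add: cross_ratio_def divide_simps) (simp add: algebra_simps)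
  show ?thesis using * cr[of "k x" "k y" "k b"] cr[of "f x" "f y" "f b"] fo ko zero by simp
qed

lemma cross_ratio_translate: "cross_ratio (x - c) (a - c) (y - c) (b - c) = cross_ratio x a y b"
  by (simp add: cross_ratio_def)

text \<open>The inverse square root of \<open>f'\<close> turns the Schwarzian derivative
  \<open>S\<close> into the coefficient of a linear equation,
  \<open>\<psi>'' = - (S / 2) \<psi>\<close>. The expression \<open>2 f' f''' - 3 f''^2\<close> is
  \<open>2 S f'^2\<close>, a form without division.\<close>

lemma inverse_sqrt_derivatives:
  fixes f' f'' f''' :: "real \<Rightarrow> real"
  assumes f': "(f' has_real_derivative f'' t) (at t)"
    and f'': "(f'' has_real_derivative f''' t) (at t)"
    and pos: "f' t > 0"
  defines "\<psi> \<equiv> \<lambda>t. 1 / sqrt (f' t)"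
  shows "(\<psi> has_real_derivative - (\<psi> t ^ 3 * f'' t / 2)) (at t)"
    and "((\<lambda>t. - (\<psi> t ^ 3 * f'' t / 2)) has_real_derivative
           - (\<psi> t ^ 5 * (2 * f' t * f''' t - 3 * (f'' t)\<^sup>2) / 4)) (at t)"
proof -
  have s: "sqrt (f' t) > 0" "sqrt (f' t) * sqrt (f' t) = f' t" using pos by auto
  show 1: "(\<psi> has_real_derivative - (\<psi> t ^ 3 * f'' t / 2)) (at t)"
    unfolding \<psi>_def
    using DERIV_divide[OF DERIV_const[of 1] DERIV_chain2[OF DERIV_real_sqrt[OF pos] f']] s
    by (simp add: field_simps power3_eq_cube)
  have "\<psi> t ^ 3 = \<psi> t ^ 5 * f' t"
    using s by (simp add: \<psi>_def field_simps power2_eq_square power3_eq_cube eval_nat_numeral)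
  hence "\<psi> t ^ 5 * (2 * f' t * f''' t - 3 * (f'' t)\<^sup>2)
      = 2 * \<psi> t ^ 3 * f''' t - 3 * \<psi> t ^ 5 * (f'' t)\<^sup>2"
    by (simp add: algebra_simps)
  moreover have "((\<lambda>t. - (\<psi> t ^ 3 * f'' t / 2)) has_real_derivative
      - ((2 * \<psi> t ^ 3 * f''' t - 3 * \<psi> t ^ 5 * (f'' t)\<^sup>2) / 4)) (at t)"
    by (auto intro!: derivative_eq_intros 1 f'' simp: field_simps eval_nat_numeral)
  ultimately show "((\<lambda>t. - (\<psi> t ^ 3 * f'' t / 2)) has_real_derivative
           - (\<psi> t ^ 5 * (2 * f' t * f''' t - 3 * (f'' t)\<^sup>2) / 4)) (at t)"
    by simp
qed

text \<open>The function \<open>c\<close> lies between twice the Schwarzian derivative of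
  \<open>f\<close> and twice that of \<open>k\<close>. Subtracting the values at \<open>a\<close>
  gives the normalization in which the two maps were compared.\<close>

lemma cross_ratio_compare:
  fixes f f' f'' f''' k k' k'' k''' :: "real \<Rightarrow> real"
  assumes ord: "x < a" "a < y" "y < b"
    and f: "\<And>t. \<lbrakk>x \<le> t; t \<le> b\<rbrakk> \<Longrightarrow> (f has_real_derivative f' t) (at t)"
      "\<And>t. \<lbrakk>x \<le> t; t \<le> b\<rbrakk> \<Longrightarrow> (f' has_real_derivative f'' t) (at t)"
      "\<And>t. \<lbrakk>x \<le> t; t \<le> b\<rbrakk> \<Longrightarrow> (f'' has_real_derivative f''' t) (at t)"
    and k: "\<And>t. \<lbrakk>x \<le> t; t \<le> b\<rbrakk> \<Longrightarrow> (k has_real_derivative k' t) (at t)"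
      "\<And>t. \<lbrakk>x \<le> t; t \<le> b\<rbrakk> \<Longrightarrow> (k' has_real_derivative k'' t) (at t)"
      "\<And>t. \<lbrakk>x \<le> t; t \<le> b\<rbrakk> \<Longrightarrow> (k'' has_real_derivative k''' t) (at t)"
    and pos: "\<And>t. \<lbrakk>x \<le> t; t \<le> b\<rbrakk> \<Longrightarrow> f' t > 0" "\<And>t. \<lbrakk>x \<le> t; t \<le> b\<rbrakk> \<Longrightarrow> k' t > 0"
    and S: "\<And>t. \<lbrakk>x \<le> t; t \<le> b\<rbrakk> \<Longrightarrow> 2 * f' t * f''' t - 3 * (f'' t)\<^sup>2 \<le> c t * (f' t)\<^sup>2"
      "\<And>t. \<lbrakk>x \<le> t; t \<le> b\<rbrakk> \<Longrightarrow> c t * (k' t)\<^sup>2 \<le> 2 * k' t * k''' t - 3 * (k'' t)\<^sup>2"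
  shows "cross_ratio (k x) (k a) (k y) (k b) \<le> cross_ratio (f x) (f a) (f y) (f b)"
proof -
  define \<psi> where "\<psi> t = 1 / sqrt (f' t)" for t
  define \<phi> where "\<phi> t = 1 / sqrt (k' t)" for t
  have "cross_ratio (k x - k a) (k a - k a) (k y - k a) (k b - k a)
      \<le> cross_ratio (f x - f a) (f a - f a) (f y - f a) (f b - f a)"
  proof (rule cross_ratio_compare_aux[OF ord, where f = "\<lambda>t. f t - f a" and k = "\<lambda>t. k t - k a"
      and \<psi> = \<psi> and \<psi>' = "\<lambda>t. - (\<psi> t ^ 3 * f'' t / 2)"
      and \<psi>'' = "\<lambda>t. - (\<psi> t ^ 5 * (2 * f' t * f''' t - 3 * (f'' t)\<^sup>2) / 4)"
      and \<phi> = \<phi> and \<phi>' = "\<lambda>t. - (\<phi> t ^ 3 * k'' t / 2)"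
      and \<phi>'' = "\<lambda>t. - (\<phi> t ^ 5 * (2 * k' t * k''' t - 3 * (k'' t)\<^sup>2) / 4)"])
    fix t assume t: "x \<le> t" "t \<le> b"
    have p: "f' t > 0" "k' t > 0" using pos[OF t] by auto
    have \<psi>2: "1 / (\<psi> t)\<^sup>2 = f' t" and \<phi>2: "1 / (\<phi> t)\<^sup>2 = k' t"
      using p by (auto simp: \<psi>_def \<phi>_def power_divide)
    show "((\<lambda>t. f t - f a) has_real_derivative 1 / (\<psi> t)\<^sup>2) (at t)"
      unfolding \<psi>2 by (auto intro!: derivative_eq_intros f(1)[OF t])
    show "((\<lambda>t. k t - k a) has_real_derivative 1 / (\<phi> t)\<^sup>2) (at t)"
      unfolding \<phi>2 by (auto intro!: derivative_eq_intros k(1)[OF t])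
    show "0 < \<psi> t" "0 < \<phi> t" using p by (auto simp: \<psi>_def \<phi>_def)
    note * = inverse_sqrt_derivatives[of f' f'' t f''', OF f(2,3)[OF t] p(1), folded \<psi>_def]
      inverse_sqrt_derivatives[of k' k'' t k''', OF k(2,3)[OF t] p(2), folded \<phi>_def]
    show "(\<psi> has_real_derivative - (\<psi> t ^ 3 * f'' t / 2)) (at t)"
     "((\<lambda>t. - (\<psi> t ^ 3 * f'' t / 2)) has_real_derivative
           - (\<psi> t ^ 5 * (2 * f' t * f''' t - 3 * (f'' t)\<^sup>2) / 4)) (at t)"
     "(\<phi> has_real_derivative - (\<phi> t ^ 3 * k'' t / 2)) (at t)"
     "((\<lambda>t. - (\<phi> t ^ 3 * k'' t / 2)) has_real_derivative
           - (\<phi> t ^ 5 * (2 * k' t * k''' t - 3 * (k'' t)\<^sup>2) / 4)) (at t)"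
      using * unfolding \<psi>_def[abs_def] \<phi>_def[abs_def] by blast+
    have "(\<psi> t)\<^sup>2 * f' t = 1" "(\<phi> t)\<^sup>2 * k' t = 1"
      using p by (auto simp: \<psi>_def \<phi>_def power_divide)
    hence "\<psi> t * ((\<psi> t)\<^sup>2 * f' t)\<^sup>2 = \<psi> t" "\<phi> t * ((\<phi> t)\<^sup>2 * k' t)\<^sup>2 = \<phi> t"
      by simp_all
    hence p5: "\<psi> t ^ 5 * (f' t)\<^sup>2 = \<psi> t" "\<phi> t ^ 5 * (k' t)\<^sup>2 = \<phi> t"
      by (simp_all add: eval_nat_numeral mult_ac)
    have "\<psi> t ^ 5 * (2 * f' t * f''' t - 3 * (f'' t)\<^sup>2) \<le> \<psi> t ^ 5 * (c t * (f' t)\<^sup>2)"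
      using S(1)[OF t] \<open>0 < \<psi> t\<close> by (intro mult_left_mono) auto
    also have "\<dots> = c t * \<psi> t" using p5(1) by (metis mult.left_commute)
    finally have 1: "\<phi> t * (\<psi> t ^ 5 * (2 * f' t * f''' t - 3 * (f'' t)\<^sup>2)) \<le> \<phi> t * (c t * \<psi> t)"
      using \<open>0 < \<phi> t\<close> by (intro mult_left_mono) auto
    have "\<phi> t ^ 5 * (c t * (k' t)\<^sup>2) \<le> \<phi> t ^ 5 * (2 * k' t * k''' t - 3 * (k'' t)\<^sup>2)"
      using S(2)[OF t] \<open>0 < \<phi> t\<close> by (intro mult_left_mono) auto
    moreover have "\<phi> t ^ 5 * (c t * (k' t)\<^sup>2) = c t * \<phi> t" using p5(2) by (metis mult.left_commute)
    ultimately have 2: "\<psi> t * (c t * \<phi> t) \<le> \<psi> t * (\<phi> t ^ 5 * (2 * k' t * k''' t - 3 * (k'' t)\<^sup>2))"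
      using \<open>0 < \<psi> t\<close> by (intro mult_left_mono) auto
    have "\<phi> t * (c t * \<psi> t) = \<psi> t * (c t * \<phi> t)" by simp
    from order_trans[OF 1[unfolded this] 2] show "\<psi> t * - (\<phi> t ^ 5 * (2 * k' t * k''' t - 3 * (k'' t)\<^sup>2) / 4)
         \<le> \<phi> t * - (\<psi> t ^ 5 * (2 * f' t * f''' t - 3 * (f'' t)\<^sup>2) / 4)"
      by linarith
  qed auto
  thus ?thesis by (simp only: cross_ratio_translate)
qed

text \<open>Each difference of squares splits into a difference and a sum. The explicit factor is
  the gain at the critical point, and it also measures the loss under a square root.\<close>

lemma cross_ratio_square:
  assumes "0 < x" "x < a" "a < y" "y < b"
  shows "cross_ratio (x\<^sup>2) (a\<^sup>2) (y\<^sup>2) (b\<^sup>2) =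
    (1 + (b - a) * (y - x) / ((a + x) * (b + y))) * cross_ratio x a y b"
proof -
  have f: "u\<^sup>2 - v\<^sup>2 = (u - v) * (u + v)" for u v :: real by (simp add: power2_eq_square algebra_simps)
  have "(y + a) * (b + x) = (a + x) * (b + y) + (b - a) * (y - x)" by (simp add: algebra_simps)
  hence e: "(y + a) * (b + x) / ((a + x) * (b + y)) = 1 + (b - a) * (y - x) / ((a + x) * (b + y))"
    using assms by (simp add: add_divide_distrib)
  have "cross_ratio (x\<^sup>2) (a\<^sup>2) (y\<^sup>2) (b\<^sup>2) = (y + a) * (b + x) / ((a + x) * (b + y)) * cross_ratio x a y b"
    unfolding cross_ratio_def f by (simp add: mult_ac)
  thus ?thesis by (simp add: e)
qed

text \<open>The comparison map is \<open>t \<mapsto> t\<^sup>2\<close>, whose Schwarzian derivative is \<open>-3/(2t\<^sup>2)\<close>.\<close>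
lemma cross_ratio_expand_near_critical:
  fixes f f' f'' f''' :: "real \<Rightarrow> real"
  assumes ord: "0 < x" "x < a" "a < y" "y < b"
    and f: "\<And>t. \<lbrakk>x \<le> t; t \<le> b\<rbrakk> \<Longrightarrow> (f has_real_derivative f' t) (at t)"
      "\<And>t. \<lbrakk>x \<le> t; t \<le> b\<rbrakk> \<Longrightarrow> (f' has_real_derivative f'' t) (at t)"
      "\<And>t. \<lbrakk>x \<le> t; t \<le> b\<rbrakk> \<Longrightarrow> (f'' has_real_derivative f''' t) (at t)"
    and pos: "\<And>t. \<lbrakk>x \<le> t; t \<le> b\<rbrakk> \<Longrightarrow> f' t > 0"
    and S: "\<And>t. \<lbrakk>x \<le> t; t \<le> b\<rbrakk> \<Longrightarrow> 2 * f' t * f''' t - 3 * (f'' t)\<^sup>2 \<le> - 3 / t\<^sup>2 * (f' t)\<^sup>2"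
  shows "(1 + (b - a) * (y - x) / ((a + x) * (b + y))) * cross_ratio x a y b
    \<le> cross_ratio (f x) (f a) (f y) (f b)"
proof -
  have "cross_ratio (x\<^sup>2) (a\<^sup>2) (y\<^sup>2) (b\<^sup>2) \<le> cross_ratio (f x) (f a) (f y) (f b)"
  proof (rule cross_ratio_compare[OF ord(2-4) f, where k' = "\<lambda>t. 2 * t" and k'' = "\<lambda>t. 2"
       and k''' = "\<lambda>t. 0" and c = "\<lambda>t. - 3 / t\<^sup>2"])
    fix t assume t: "x \<le> t" "t \<le> b"
    hence "t > 0" using ord by simp
    show "((\<lambda>t. t\<^sup>2) has_real_derivative 2 * t) (at t)" by (auto intro!: derivative_eq_intros)
    show "((\<lambda>t. 2 * t) has_real_derivative 2) (at t)" by (auto intro!: derivative_eq_intros)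
    show "- 3 / t\<^sup>2 * (2 * t)\<^sup>2 \<le> 2 * (2 * t) * 0 - 3 * 2\<^sup>2"
      using \<open>t > 0\<close> by (simp add: power_mult_distrib)
    show "0 < 2 * t" using \<open>t > 0\<close> by simp
  qed (use pos S in auto)
  thus ?thesis using cross_ratio_square[OF ord] by simp
qed

text \<open>The comparison map is \<open>t \<mapsto> sqrt t\<close>, whose Schwarzian derivative is \<open>3/(8t\<^sup>2)\<close>,
  on an interval of length at most \<open>1/(4C)\<close> that is translated to \<open>[1/(4C), 1/(2C)]\<close>.\<close>
lemma cross_ratio_distortion:
  fixes f f' f'' f''' :: "real \<Rightarrow> real"
  assumes C: "C \<ge> 1" and uv: "v - u \<le> 1 / (4 * C)"
    and ord: "u \<le> x" "x < a" "a < y" "y < b" "b \<le> v"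
    and f: "\<And>t. \<lbrakk>x \<le> t; t \<le> b\<rbrakk> \<Longrightarrow> (f has_real_derivative f' t) (at t)"
      "\<And>t. \<lbrakk>x \<le> t; t \<le> b\<rbrakk> \<Longrightarrow> (f' has_real_derivative f'' t) (at t)"
      "\<And>t. \<lbrakk>x \<le> t; t \<le> b\<rbrakk> \<Longrightarrow> (f'' has_real_derivative f''' t) (at t)"
    and pos: "\<And>t. \<lbrakk>x \<le> t; t \<le> b\<rbrakk> \<Longrightarrow> f' t > 0"
    and S: "\<And>t. \<lbrakk>x \<le> t; t \<le> b\<rbrakk> \<Longrightarrow> 2 * f' t * f''' t - 3 * (f'' t)\<^sup>2 \<le> C * (f' t)\<^sup>2"
  shows "cross_ratio x a y b \<le> (1 + C\<^sup>2 * (v - u)\<^sup>2) * cross_ratio (f x) (f a) (f y) (f b)"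
proof -
  define Z where "Z = 1 / (4 * C)"
  have Z: "Z > 0" using C by (simp add: Z_def)
  define k where "k t = sqrt (t - u + Z)" for t
  have s: "t - u + Z > 0" "Z \<le> t - u + Z" "t - u + Z \<le> 2 * Z" if "x \<le> t" "t \<le> b" for t
    using that ord Z uv unfolding Z_def[symmetric] by linarith+
  have cmp: "cross_ratio (k x) (k a) (k y) (k b) \<le> cross_ratio (f x) (f a) (f y) (f b)"
  proof (rule cross_ratio_compare[OF ord(2-4) f, where k' = "\<lambda>t. 1 / (2 * k t)"
       and k'' = "\<lambda>t. - 1 / (4 * k t ^ 3)" and k''' = "\<lambda>t. 3 / (8 * k t ^ 5)" and c = "\<lambda>t. C"])
    fix t assume t: "x \<le> t" "t \<le> b"
    have kp: "k t > 0" "k t * k t = t - u + Z" using s[OF t] by (auto simp: k_def)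
    show 1: "(k has_real_derivative 1 / (2 * k t)) (at t)"
      unfolding k_def using s(1)[OF t] by (auto intro!: derivative_eq_intros simp: field_simps)
    show "((\<lambda>t. 1 / (2 * k t)) has_real_derivative - 1 / (4 * k t ^ 3)) (at t)"
      apply (rule derivative_eq_intros 1 | use kp in force)+
      using kp(1) by (simp add: field_simps eval_nat_numeral)
    show "((\<lambda>t. - 1 / (4 * k t ^ 3)) has_real_derivative 3 / (8 * k t ^ 5)) (at t)"
      apply (rule derivative_eq_intros 1 | use kp in force)+
      using kp(1) by (simp add: field_simps eval_nat_numeral)
    show "0 < 1 / (2 * k t)" using kp by simp
    have E1: "2 * (1 / (2 * k t)) * (3 / (8 * k t ^ 5)) - 3 * (- 1 / (4 * k t ^ 3))\<^sup>2
       = 3 / (16 * (k t * k t) ^ 2) * (1 / (k t * k t))"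
      using kp(1) by (simp add: field_simps eval_nat_numeral)
    have E2: "C * (1 / (2 * k t))\<^sup>2 = C / 4 * (1 / (k t * k t))"
      using kp(1) by (simp add: field_simps eval_nat_numeral)
    \<comment> \<open>On \<open>[Z, 2 Z]\<close> twice the Schwarzian derivative of the square root
      is at least \<open>3 C^2\<close>, which dominates \<open>C\<close> because
      \<open>C \<ge> 1\<close>.\<close>
    have "C / 4 \<le> 3 / (16 * (k t * k t) ^ 2)"
    proof -
      have "(k t * k t)\<^sup>2 \<le> (2 * Z)\<^sup>2" using s[OF t] kp by (intro power_mono) auto
      hence "3 / (16 * (2 * Z)\<^sup>2) \<le> 3 / (16 * (k t * k t) ^ 2)"
        using kp Z by (intro divide_left_mono mult_pos_pos zero_less_power) auto
      moreover have "3 / (16 * (2 * Z)\<^sup>2) = 3 * C\<^sup>2 / 4"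
        using C by (simp add: Z_def field_simps power2_eq_square)
      moreover have "C * 1 \<le> C * C" using C by (intro mult_left_mono) auto
      moreover have "C\<^sup>2 = C * C" by (simp add: power2_eq_square)
      ultimately show ?thesis using C by linarith
    qed
    then show "C * (1 / (2 * k t))\<^sup>2
      \<le> 2 * (1 / (2 * k t)) * (3 / (8 * k t ^ 5)) - 3 * (- 1 / (4 * k t ^ 3))\<^sup>2"
      unfolding E1 E2 using kp(1) by (intro mult_right_mono) auto
  qed (use pos S in auto)
  have ksq: "(k t)\<^sup>2 = t - u + Z" if "x \<le> t" "t \<le> b" for t
    using s[OF that] by (simp add: k_def)
  have kpos: "k x > 0" and kord: "k x < k a" "k a < k y" "k y < k b"
    using s[of x] ord by (auto simp: k_def)
  \<comment> \<open>Squaring \<open>k\<close> gives a translation, so the loss under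
    \<open>k\<close> is exactly the factor of \<open>cross_ratio_square\<close>. As
    \<open>k \<ge> sqrt Z\<close>, its slope is at most \<open>1 / (2 sqrt Z)\<close>, which bounds
    the excess of that factor over 1.\<close>
  have "cross_ratio x a y b = cross_ratio ((k x)\<^sup>2) ((k a)\<^sup>2) ((k y)\<^sup>2) ((k b)\<^sup>2)"
    using ksq ord by (simp add: cross_ratio_def)
  also have "\<dots> = (1 + (k b - k a) * (k y - k x) / ((k a + k x) * (k b + k y)))
      * cross_ratio (k x) (k a) (k y) (k b)"
    by (rule cross_ratio_square[OF kpos kord])
  also have "\<dots> \<le> (1 + C\<^sup>2 * (v - u)\<^sup>2) * cross_ratio (k x) (k a) (k y) (k b)"
  proof (rule mult_right_mono)
    have kl: "k t \<ge> sqrt Z" if "x \<le> t" "t \<le> b" for t using s[OF that] by (simp add: k_def)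
    have sZ: "sqrt Z > 0" "sqrt Z * sqrt Z = Z" using Z by auto
    have dif: "k q - k p \<le> (v - u) / (2 * sqrt Z)" if "x \<le> p" "p < q" "q \<le> b" for p q
    proof -
      have "(k q - k p) * (k q + k p) = q - p"
        using ksq[of p] ksq[of q] that by (simp add: power2_eq_square algebra_simps)
      moreover have "k q - k p \<ge> 0" using that by (simp add: k_def)
      moreover have "2 * sqrt Z \<le> k q + k p" using kl[of p] kl[of q] that by auto
      ultimately have "(k q - k p) * (2 * sqrt Z) \<le> q - p"
        by (metis mult_left_mono)
      thus ?thesis using sZ that ord by (simp add: pos_le_divide_eq)
    qed
    have "(k b - k a) * (k y - k x) \<le> ((v - u) / (2 * sqrt Z)) * ((v - u) / (2 * sqrt Z))"
      using dif[of a b] dif[of x y] kord ord by (intro mult_mono) auto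
    also have "\<dots> = (v - u)\<^sup>2 / (4 * Z)" using sZ by (simp add: power2_eq_square)
    finally have n: "(k b - k a) * (k y - k x) \<le> (v - u)\<^sup>2 / (4 * Z)" .
    have "(2 * sqrt Z) * (2 * sqrt Z) \<le> (k a + k x) * (k b + k y)"
    proof (rule mult_mono)
      have "sqrt Z \<le> k x" "sqrt Z \<le> k a" "sqrt Z \<le> k y" "sqrt Z \<le> k b"
        using kl ord by simp_all
      thus "2 * sqrt Z \<le> k a + k x" "2 * sqrt Z \<le> k b + k y" "0 \<le> k a + k x" "0 \<le> 2 * sqrt Z"
        using sZ by linarith+
    qed
    hence d: "4 * Z \<le> (k a + k x) * (k b + k y)" using sZ by simp
    have "(k b - k a) * (k y - k x) / ((k a + k x) * (k b + k y)) \<le> ((v - u)\<^sup>2 / (4 * Z)) / (4 * Z)"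
      using n d Z by (intro frac_le) simp_all
    also have "\<dots> = C\<^sup>2 * (v - u)\<^sup>2" using C by (simp add: Z_def power2_eq_square)
    finally show "1 + (k b - k a) * (k y - k x) / ((k a + k x) * (k b + k y)) \<le> 1 + C\<^sup>2 * (v - u)\<^sup>2"
      by simp
    show "0 \<le> cross_ratio (k x) (k a) (k y) (k b)" using cross_ratio_pos[OF kord] by simp
  qed
  also have "\<dots> \<le> (1 + C\<^sup>2 * (v - u)\<^sup>2) * cross_ratio (f x) (f a) (f y) (f b)"
    using cmp by (intro mult_left_mono) auto
  finally show ?thesis .
qed

section \<open>Continued fractions\<close>

text \<open>The recursion follows \<open>1 / (k + n / d) = d / (k d + n)\<close> without reducing;
  coprimality comes from the determinant identity below.\<close>

fun cf_num cf_den :: "nat list \<Rightarrow> nat" where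
  "cf_num [] = 0"
| "cf_num (k # ks) = cf_den ks"
| "cf_den [] = 1"
| "cf_den (k # ks) = k * cf_den ks + cf_num ks"

lemma cf_den_pos: "\<forall>k\<in>set ks. k \<ge> 1 \<Longrightarrow> cf_den ks \<ge> 1"
  by (induction ks) (auto intro: Suc_leI)

lemma cf_value_eq:
  "\<forall>k\<in>set ks. k \<ge> 1 \<Longrightarrow> cf_value ks = of_nat (cf_num ks) / of_nat (cf_den ks)"
proof (induction ks)
  case (Cons k ks)
  have "cf_den ks \<ge> 1" "cf_den (k # ks) \<ge> 1"
    using cf_den_pos[of ks] cf_den_pos[of "k # ks"] Cons.prems by auto
  hence "(of_nat (cf_den ks) :: rat) \<noteq> 0" by simp
  moreover from this have "of_nat k + of_nat (cf_num ks) / of_nat (cf_den ks)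
      = (of_nat (cf_den (k # ks)) / of_nat (cf_den ks) :: rat)"
    by (simp add: field_simps)
  ultimately show ?case using Cons by simp
qed simp

text \<open>The defining recursion peels off the first quotient; appending at the end gives the
  three-term recurrence of the convergents.\<close>

lemma cf_snoc:
  "cf_num (ks @ [x, y]) = y * cf_num (ks @ [x]) + cf_num ks \<and>
   cf_den (ks @ [x, y]) = y * cf_den (ks @ [x]) + cf_den ks"
  by (induction ks) (auto simp: algebra_simps)

definition cf_p :: "(nat \<Rightarrow> nat) \<Rightarrow> nat \<Rightarrow> nat" where "cf_p a n = cf_num (map a [1..<Suc n])"
definition cf_q :: "(nat \<Rightarrow> nat) \<Rightarrow> nat \<Rightarrow> nat" where "cf_q a n = cf_den (map a [1..<Suc n])"

lemma cf_pq_simps [simp]: "cf_p a 0 = 0" "cf_q a 0 = 1" "cf_p a (Suc 0) = 1" "cf_q a (Suc 0) = a 1"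
  by (auto simp: cf_p_def cf_q_def)

lemma cf_pq_rec:
  "cf_p a (Suc (Suc n)) = a (Suc (Suc n)) * cf_p a (Suc n) + cf_p a n"
  "cf_q a (Suc (Suc n)) = a (Suc (Suc n)) * cf_q a (Suc n) + cf_q a n"
  using cf_snoc[of "map a [1..<Suc n]" "a (Suc n)" "a (Suc (Suc n))"]
  by (auto simp: cf_p_def cf_q_def)

lemma cf_pq_det: "int (cf_p a (Suc n)) * int (cf_q a n) - int (cf_p a n) * int (cf_q a (Suc n)) = (- 1) ^ n"
proof (induction n)
  case (Suc n)
  have "int (cf_p a (Suc (Suc n))) * int (cf_q a (Suc n)) - int (cf_p a (Suc n)) * int (cf_q a (Suc (Suc n)))
      = - (int (cf_p a (Suc n)) * int (cf_q a n) - int (cf_p a n) * int (cf_q a (Suc n)))"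
    by (simp add: cf_pq_rec algebra_simps)
  thus ?case using Suc by simp
qed simp

context
  fixes a :: "nat \<Rightarrow> nat"
  assumes a1: "\<forall>m\<ge>1. a m \<ge> 1"
begin

lemma cf_q_pos: "cf_q a n \<ge> 1"
  unfolding cf_q_def using a1 by (intro cf_den_pos) auto

lemma cf_q_ge: "n \<le> cf_q a n"
proof (induction n rule: less_induct)
  case (less n)
  consider "n = 0" | "n = 1" | k where "n = Suc (Suc k)" by (metis One_nat_def not0_implies_Suc)
  thus ?case
  proof cases
    case 3
    have "1 * cf_q a (Suc k) \<le> a n * cf_q a (Suc k)" using a1 3 by (intro mult_right_mono) auto
    moreover have "Suc k \<le> cf_q a (Suc k)" using less 3 by auto
    ultimately show ?thesis using cf_q_pos[of k] unfolding 3 cf_pq_rec by linarith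
  qed (use a1 in auto)
qed

lemma cf_q_mono: "m \<le> n \<Longrightarrow> cf_q a m \<le> cf_q a n"
proof (rule lift_Suc_mono_le[of "cf_q a"])
  fix n show "cf_q a n \<le> cf_q a (Suc n)"
  proof (cases n)
    case (Suc k)
    have "1 * cf_q a (Suc k) \<le> a (Suc (Suc k)) * cf_q a (Suc k)" using a1 by (intro mult_right_mono) auto
    thus ?thesis unfolding Suc cf_pq_rec by linarith
  qed (use a1 in auto)
qed

lemma cf_convergent_eq: "cf_convergent a n = of_nat (cf_p a n) / of_nat (cf_q a n)"
  unfolding cf_convergent_def cf_p_def cf_q_def using a1 by (intro cf_value_eq) auto

lemma coprime_cf_pq: "coprime (int (cf_p a n)) (int (cf_q a n))"
proof (rule coprimeI)
  fix c assume c: "c dvd int (cf_p a n)" "c dvd int (cf_q a n)"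
  hence "c dvd int (cf_p a (Suc n)) * int (cf_q a n) - int (cf_p a n) * int (cf_q a (Suc n))"
    by (intro dvd_diff dvd_mult2 dvd_mult)
  hence "c dvd (- 1) ^ n" by (simp only: cf_pq_det)
  thus "is_unit c" by (cases "even n") auto
qed

lemma cf_denom_eq: "cf_denom a n = cf_q a n"
proof -
  have "cf_convergent a n = Fract (int (cf_p a n)) (int (cf_q a n))"
    using cf_q_pos[of n] by (simp add: cf_convergent_eq Fract_of_int_quotient)
  thus ?thesis
    using cf_q_pos[of n] coprime_cf_pq[of n]
    by (simp add: cf_denom_def quotient_of_Fract normalize_stable)
qed

text \<open>This is \<open>|q_n \<theta> - p_n|\<close>: the convergents lie alternately below and
  above \<open>\<theta>\<close>, and the sign of the difference is built in.\<close>

definition cf_err :: "real \<Rightarrow> nat \<Rightarrow> real" where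
  "cf_err \<theta> n = (- 1) ^ n * (real (cf_q a n) * \<theta> - real (cf_p a n))"

lemma cf_err_rec: "cf_err \<theta> n = real (a (Suc (Suc n))) * cf_err \<theta> (Suc n) + cf_err \<theta> (Suc (Suc n))"
  by (simp add: cf_err_def cf_pq_rec algebra_simps)

lemma cf_err_det: "cf_err \<theta> n * real (cf_q a (Suc n)) + cf_err \<theta> (Suc n) * real (cf_q a n) = 1"
proof -
  have "real_of_int (int (cf_p a (Suc n)) * int (cf_q a n) - int (cf_p a n) * int (cf_q a (Suc n))) = (- 1) ^ n"
    by (simp only: cf_pq_det) simp
  hence d: "real (cf_p a (Suc n)) * real (cf_q a n) - real (cf_p a n) * real (cf_q a (Suc n)) = (- 1) ^ n"
    by simp
  have "cf_err \<theta> n * real (cf_q a (Suc n)) + cf_err \<theta> (Suc n) * real (cf_q a n) =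
    (- 1) ^ n * (real (cf_p a (Suc n)) * real (cf_q a n) - real (cf_p a n) * real (cf_q a (Suc n)))"
    by (simp add: cf_err_def algebra_simps)
  also have "\<dots> = 1" unfolding d by (simp flip: power_add)
  finally show ?thesis .
qed

text \<open>With the sign \<open>(-1)^n\<close>, the convergents of index \<open>n\<close>,
  \<open>n + 2\<close>, ... increase strictly to their limit, so the first of them lies strictly
  below it.\<close>

lemma cf_err_pos:
  assumes lim: "(\<lambda>n. real_of_rat (cf_convergent a n)) \<longlonglongrightarrow> \<theta>"
  shows "cf_err \<theta> n > 0"
proof -
  define r where "r n = real (cf_p a n) / real (cf_q a n)" for n
  have qp: "real (cf_q a n) > 0" for n using cf_q_pos[of n] by simp
  have r: "real_of_rat (cf_convergent a n) = r n" for n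
    by (simp add: cf_convergent_eq r_def of_rat_divide)
  define X where "X k = (- 1) ^ n * r (n + 2 * k)" for k
  have step: "X k < X (Suc k)" for k
  proof -
    define m where "m = n + 2 * k"
    have d: "real (cf_p a (Suc m)) * real (cf_q a m) - real (cf_p a m) * real (cf_q a (Suc m)) = (- 1) ^ m"
    proof -
      have "real_of_int (int (cf_p a (Suc m)) * int (cf_q a m) - int (cf_p a m) * int (cf_q a (Suc m))) = (- 1) ^ m"
        by (simp only: cf_pq_det) simp
      thus ?thesis by simp
    qed
    have "r (Suc (Suc m)) - r m = real (a (Suc (Suc m))) *
        (real (cf_p a (Suc m)) * real (cf_q a m) - real (cf_p a m) * real (cf_q a (Suc m)))
        / (real (cf_q a m) * real (cf_q a (Suc (Suc m))))"
      using qp[of m] qp[of "Suc (Suc m)"] unfolding r_def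
      by (simp add: diff_frac_eq) (simp add: cf_pq_rec algebra_simps)
    also have "\<dots> = (- 1) ^ m * (real (a (Suc (Suc m))) / (real (cf_q a m) * real (cf_q a (Suc (Suc m)))))"
      unfolding d by simp
    finally have "X (Suc k) - X k = ((- 1) ^ n * (- 1) ^ m) * (real (a (Suc (Suc m))) / (real (cf_q a m) * real (cf_q a (Suc (Suc m)))))"
      by (simp add: X_def m_def algebra_simps)
    also have "(- 1) ^ n * (- 1) ^ m = (1 :: real)" by (simp add: m_def power_add power_mult flip: power_mult_distrib)
    also have "1 * (real (a (Suc (Suc m))) / (real (cf_q a m) * real (cf_q a (Suc (Suc m))))) > 0"
      using qp a1 by (simp add: Suc_le_lessD)
    finally show ?thesis by simp
  qed
  have "X \<longlonglongrightarrow> (- 1) ^ n * \<theta>"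
  proof -
    have "(\<lambda>k. r (n + 2 * k)) \<longlonglongrightarrow> \<theta>"
      using LIMSEQ_subseq_LIMSEQ[OF lim[unfolded r], of "\<lambda>k. n + 2 * k"]
      by (simp add: o_def strict_mono_def)
    thus ?thesis unfolding X_def by (intro tendsto_mult_left)
  qed
  moreover have "incseq X" using step by (intro incseq_SucI) (simp add: less_imp_le)
  ultimately have "X 1 \<le> (- 1) ^ n * \<theta>" by (intro incseq_le)
  with step[of 0] have "(- 1) ^ n * r n < (- 1) ^ n * \<theta>" by (simp add: X_def)
  hence "real (cf_q a n) * ((- 1) ^ n * r n) < real (cf_q a n) * ((- 1) ^ n * \<theta>)"
    using qp[of n] by (rule mult_strict_left_mono)
  moreover have "real (cf_q a n) * ((- 1) ^ n * r n) = (- 1) ^ n * real (cf_p a n)"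
    using qp[of n] by (simp add: r_def)
  ultimately have "(- 1) ^ n * real (cf_p a n) < real (cf_q a n) * ((- 1) ^ n * \<theta>)" by (simp only:)
  thus ?thesis by (simp add: cf_err_def algebra_simps)
qed

text \<open>The determinant identity bounds the error by \<open>1 / q_(n+1)\<close>, and
  \<open>q_(n+1) \<ge> n + 1\<close>. The explicit rate makes the returns short from a computable
  level on.\<close>

lemma cf_err_le:
  assumes lim: "(\<lambda>n. real_of_rat (cf_convergent a n)) \<longlonglongrightarrow> \<theta>"
  shows "cf_err \<theta> n \<le> 1 / real (Suc n)"
proof -
  have "cf_err \<theta> n * real (Suc n) \<le> cf_err \<theta> n * real (cf_q a (Suc n))"
    using cf_err_pos[OF lim, of n] cf_q_ge[of "Suc n"] by (intro mult_left_mono) auto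
  also have "\<dots> \<le> 1"
    using cf_err_det[of \<theta> n] cf_err_pos[OF lim, of "Suc n"]
    by (smt (verit) mult_nonneg_nonneg of_nat_0_le_iff)
  finally show ?thesis by (simp add: pos_le_divide_eq)
qed

text \<open>The pair \<open>(j, v)\<close> is an integer combination of the \<open>n\<close>-th and
  the next pair \<open>(q, p)\<close>. Since \<open>0 < j < q_(n+1)\<close>, the first coefficient
  is nonzero and the second has the opposite sign or vanishes; as consecutive errors alternate in
  sign, the two contributions add up.\<close>

lemma cf_best_approximation:
  assumes lim: "(\<lambda>n. real_of_rat (cf_convergent a n)) \<longlonglongrightarrow> \<theta>"
    and j: "0 < j" "j < int (cf_q a (Suc n))"
  shows "cf_err \<theta> n \<le> \<bar>real_of_int j * \<theta> - real_of_int v\<bar>"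
proof -
  define p q p' q' where "p = int (cf_p a n)" and "q = int (cf_q a n)"
    and "p' = int (cf_p a (Suc n))" and "q' = int (cf_q a (Suc n))"
  define s :: int where "s = (- 1) ^ n"
  have det: "p' * q - p * q' = s" unfolding p_def q_def p'_def q'_def s_def by (rule cf_pq_det)
  have ss: "s * s = 1" by (simp add: s_def flip: power_add)
  \<comment> \<open>Cramer's rule; the determinant \<open>s\<close> is its own inverse.\<close>
  define \<alpha> where "\<alpha> = s * (p' * j - q' * v)"
  define \<beta> where "\<beta> = s * (q * v - p * j)"
  have j': "j = \<alpha> * q + \<beta> * q'"
  proof -
    have "\<alpha> * q + \<beta> * q' = s * (p' * q - p * q') * j" by (simp add: \<alpha>_def \<beta>_def algebra_simps)
    thus ?thesis using ss det by simp
  qed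
  have v': "v = \<alpha> * p + \<beta> * p'"
  proof -
    have "\<alpha> * p + \<beta> * p' = s * (p' * q - p * q') * v" by (simp add: \<alpha>_def \<beta>_def algebra_simps)
    thus ?thesis using ss det by simp
  qed
  have qpos: "q \<ge> 1" "q' \<ge> 1" using cf_q_pos[of n] cf_q_pos[of "Suc n"] by (auto simp: q_def q'_def)
  have e: "cf_err \<theta> n > 0" "cf_err \<theta> (Suc n) > 0" by (rule cf_err_pos[OF lim])+
  have "real_of_int j * \<theta> - real_of_int v =
    real_of_int \<alpha> * (real_of_int q * \<theta> - real_of_int p) + real_of_int \<beta> * (real_of_int q' * \<theta> - real_of_int p')"
    unfolding j' v' by (simp add: algebra_simps)
  hence "(- 1) ^ n * (real_of_int j * \<theta> - real_of_int v) = (- 1) ^ n *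
    (real_of_int \<alpha> * (real_of_int q * \<theta> - real_of_int p) + real_of_int \<beta> * (real_of_int q' * \<theta> - real_of_int p'))"
    by (rule arg_cong)
  hence e': "(- 1) ^ n * (real_of_int j * \<theta> - real_of_int v) =
    real_of_int \<alpha> * cf_err \<theta> n - real_of_int \<beta> * cf_err \<theta> (Suc n)"
    by (simp add: cf_err_def p_def q_def p'_def q'_def algebra_simps)
  have eq: "\<bar>real_of_int j * \<theta> - real_of_int v\<bar> = \<bar>real_of_int \<alpha> * cf_err \<theta> n - real_of_int \<beta> * cf_err \<theta> (Suc n)\<bar>"
    unfolding e'[symmetric] by (simp add: abs_mult power_abs)
  have \<alpha>0: "\<alpha> \<noteq> 0"
  proof
    assume "\<alpha> = 0"
    hence "j = \<beta> * q'" using j' by simp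
    moreover have "\<beta> * q' \<le> 0" if "\<beta> \<le> 0" using that qpos by (simp add: mult_nonpos_nonneg)
    moreover have "1 * q' \<le> \<beta> * q'" if "\<beta> \<ge> 1" using that qpos by (intro mult_right_mono) auto
    ultimately show False using j by (fold q'_def) linarith
  qed
  have signs: "\<alpha> > 0 \<and> \<beta> \<le> 0 \<or> \<alpha> < 0 \<and> \<beta> \<ge> 0"
  proof (rule ccontr)
    assume "\<not> ?thesis"
    hence "\<alpha> \<ge> 1 \<and> \<beta> \<ge> 1 \<or> \<alpha> \<le> -1 \<and> \<beta> \<le> -1" using \<alpha>0 by linarith
    thus False
    proof
      assume "\<alpha> \<ge> 1 \<and> \<beta> \<ge> 1"
      hence "1 * q' \<le> \<beta> * q'" "0 \<le> \<alpha> * q" using qpos by (auto intro!: mult_right_mono)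
      thus False using j' j by (fold q'_def) linarith
    next
      assume "\<alpha> \<le> -1 \<and> \<beta> \<le> -1"
      hence "\<beta> * q' \<le> 0" "\<alpha> * q \<le> 0" using qpos by (auto simp: mult_nonpos_nonneg)
      thus False using j' j by linarith
    qed
  qed
  thus ?thesis
  proof
    assume s: "\<alpha> > 0 \<and> \<beta> \<le> 0"
    hence "1 * cf_err \<theta> n \<le> real_of_int \<alpha> * cf_err \<theta> n" using e by (intro mult_right_mono) auto
    moreover have "real_of_int \<beta> * cf_err \<theta> (Suc n) \<le> 0" using s e by (simp add: mult_nonpos_nonneg)
    ultimately show ?thesis unfolding eq by linarith
  next
    assume s: "\<alpha> < 0 \<and> \<beta> \<ge> 0"
    hence "real_of_int \<alpha> \<le> - 1" by linarith
    hence "real_of_int \<alpha> * cf_err \<theta> n \<le> (- 1) * cf_err \<theta> n" using e by (intro mult_right_mono) auto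
    moreover have "real_of_int \<beta> * cf_err \<theta> (Suc n) \<ge> 0" using s e by simp
    ultimately show ?thesis unfolding eq by linarith
  qed
qed

end

section \<open>Returns close to the critical point\<close>

text \<open>The numbers of the lemma \<open>bottleneck\<close>, in units of \<open>Y\<close>:
  \<open>D\<close> is the distance of the two points, \<open>1/16\<close> the length of the outer
  gaps, \<open>1/10^7\<close> the allowed displacement, \<open>1/256\<close> the expansion gained at
  the critical point and \<open>1001/1000\<close> the distortion of the other iterates.\<close>

lemma bottleneck_numeric:
  fixes D :: real
  assumes "1/8 \<le> D" "D \<le> 1"
  shows "1001/1000 * (((D + 1/10^7) / (1/16 - 1/10^7))\<^sup>2 - 1) < (1 + 1/256) * ((16 * D)\<^sup>2 - 1)"
proof -
  have "(D + 1/10^7) / (1/16 - 1/10^7) \<le> (1 + 1/10^5) * (16 * D)"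
    using assms by (simp add: field_simps)
  hence "((D + 1/10^7) / (1/16 - 1/10^7))\<^sup>2 \<le> ((1 + 1/10^5) * (16 * D))\<^sup>2"
    using assms by (intro power_mono) auto
  also have "\<dots> = (1 + 1/10^5)\<^sup>2 * (16 * D)\<^sup>2" by (simp only: power_mult_distrib)
  finally have 1: "((D + 1/10^7) / (1/16 - 1/10^7))\<^sup>2 \<le> (1 + 1/10^5)\<^sup>2 * (16 * D)\<^sup>2" .
  have "(16 * (1/8))\<^sup>2 \<le> (16 * D)\<^sup>2" using assms by (intro power_mono) auto
  hence "4 \<le> (16 * D)\<^sup>2" by (simp add: power2_eq_square)
  thus ?thesis using 1 by (simp add: power2_eq_square field_simps)
qed

text \<open>What the estimates use of a critical circle map, in a form stable under reflection.
  \<open>schwarz_near\<close> bounds the Schwarzian derivative of \<open>f\<close> by that of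
  \<open>t^2\<close> close to 0; away from the integers only the upper bound
  \<open>schwarz_bdd\<close> is recorded.\<close>

locale critical_lift =
  fixes f f' f'' f''' h :: "real \<Rightarrow> real" and \<theta> :: real
  assumes h_mono: "strict_mono h" and h_surj: "surj h" and h_0: "h 0 = 0"
    and h_plus_1: "\<And>x. h (x + 1) = h x + 1" and h_conj: "\<And>x. h (f x) = h x + \<theta>"
    and f_deriv: "\<And>x. (f has_real_derivative f' x) (at x)"
      "\<And>x. (f' has_real_derivative f'' x) (at x)"
      "\<And>x. (f'' has_real_derivative f''' x) (at x)"
    and f'_pos: "\<And>x. x \<notin> \<int> \<Longrightarrow> f' x > 0"
    and schwarz_near: "\<exists>\<delta>>0. \<forall>t. 0 < \<bar>t\<bar> \<and> \<bar>t\<bar> < \<delta> \<longrightarrow>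
      2 * f' t * f''' t - 3 * (f'' t)\<^sup>2 \<le> - 3 / t\<^sup>2 * (f' t)\<^sup>2"
    and schwarz_bdd: "\<exists>C. \<forall>t. t \<notin> \<int> \<longrightarrow> 2 * f' t * f''' t - 3 * (f'' t)\<^sup>2 \<le> C * (f' t)\<^sup>2"
begin

lemma h_less_iff [simp]: "h x < h y \<longleftrightarrow> x < y"
  using h_mono by (rule strict_mono_less)

lemma h_le_iff [simp]: "h x \<le> h y \<longleftrightarrow> x \<le> y"
  using h_mono by (rule strict_mono_less_eq)

lemma h_eq_iff [simp]: "h x = h y \<longleftrightarrow> x = y"
  using h_mono by (rule strict_mono_eq)

lemma h_add_int: "h (x + of_int m) = h x + of_int m"
proof -
  have nat: "h (x + of_nat k) = h x + of_nat k" for x k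
  proof (induction k)
    case (Suc k)
    show ?case using h_plus_1[of "x + of_nat k"] Suc by (simp add: algebra_simps)
  qed simp
  show ?thesis
  proof (cases "m \<ge> 0")
    case True
    thus ?thesis using nat[of x "nat m"] by simp
  next
    case False
    thus ?thesis using nat[of "x + of_int m" "nat (- m)"] by simp
  qed
qed

lemma h_diff_int: "h (x - of_int m) = h x - of_int m"
  using h_add_int[of x "- m"] by simp

lemma h_int: "h (of_int m) = of_int m"
  using h_add_int[of 0 m] h_0 by simp

lemma h_funpow: "h ((f ^^ n) x) = h x + real n * \<theta>"
  by (induction n) (auto simp: h_conj algebra_simps)

lemma funpow_less_iff [simp]: "(f ^^ n) x < (f ^^ n) y \<longleftrightarrow> x < y"
  using h_less_iff[of "(f ^^ n) x" "(f ^^ n) y"] h_less_iff[of x y]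
  unfolding h_funpow by (simp del: h_less_iff)

text \<open>Uniform continuity of the inverse of \<open>h\<close>. An interval of length at least
  \<open>\<epsilon> > 2 / N\<close> contains a whole cell of the grid of mesh \<open>1 / N\<close>,
  and by periodicity the cells have only finitely many lengths in the coordinate
  \<open>h\<close>.\<close>

lemma small_if_h_small:
  assumes "\<epsilon> > 0"
  shows "\<exists>\<delta>>0. \<forall>u v. h v - h u < \<delta> \<longrightarrow> v - u < \<epsilon>"
proof -
  obtain N :: nat where N: "N > 0" "2 / real N < \<epsilon>"
    using assms reals_Archimedean2[of "2 / \<epsilon>"] by (metis divide_less_eq less_divide_eq mult.commute
      of_nat_0_less_iff zero_less_divide_iff zero_less_numeral order_less_trans)
  define D where "D i = h ((real_of_int i + 1) / real N) - h (real_of_int i / real N)" for i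
  define \<delta> where "\<delta> = Min (D ` {0..<int N})"
  have D_mod: "D i = D (i mod int N)" for i
  proof -
    have "real_of_int i = real N * of_int (i div int N) + of_int (i mod int N)"
      by (metis mult_div_mod_eq of_int_add of_int_mult of_int_of_nat_eq)
    hence "real_of_int i / real N = real_of_int (i mod int N) / real N + of_int (i div int N)"
      "(real_of_int i + 1) / real N = (real_of_int (i mod int N) + 1) / real N + of_int (i div int N)"
      using N(1) by (simp_all add: field_simps)
    thus ?thesis by (simp add: D_def h_add_int)
  qed
  have \<delta>_pos: "\<delta> > 0"
    unfolding \<delta>_def using N(1) by (subst Min_gr_iff) (auto simp: D_def divide_strict_right_mono)
  have \<delta>_le: "\<delta> \<le> D i" for i
    unfolding \<delta>_def D_mod[of i] using N(1) by (intro Min_le) auto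
  have "v - u < \<epsilon>" if uv: "h v - h u < \<delta>" for u v
  proof (rule ccontr)
    assume n: "\<not> v - u < \<epsilon>"
    define i where "i = \<lceil>u * real N\<rceil>"
    have "u * real N \<le> real_of_int i" "real_of_int i < u * real N + 1"
      unfolding i_def by linarith+
    moreover have "2 < (v - u) * real N"
      using N n by (smt (verit) divide_less_eq mult_right_mono of_nat_0_le_iff of_nat_0_less_iff)
    ultimately have "real_of_int i + 1 \<le> v * real N" by (simp add: algebra_simps)
    with \<open>u * real N \<le> real_of_int i\<close> have "u \<le> real_of_int i / real N" "(real_of_int i + 1) / real N \<le> v"
      using N(1) by (simp_all add: field_simps)
    hence "h u \<le> h (real_of_int i / real N)" "h ((real_of_int i + 1) / real N) \<le> h v" by simp_all
    hence "D i \<le> h v - h u" unfolding D_def by linarith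
    thus False using \<delta>_le[of i] uv by linarith
  qed
  thus ?thesis using \<delta>_pos by blast
qed

end

text \<open>The rotation number of \<open>x \<mapsto> f\<^sup>q x - P\<close> is \<open>-d\<close>. The interval \<open>[0, Y]\<close> is cut into \<open>A\<close> pieces
  of equal length in the linearizing coordinate by the first \<open>A\<close> backward iterates of \<open>0\<close> under this
  map.\<close>
locale critical_return = critical_lift +
  fixes q :: nat and P :: int and d :: real and A :: nat and Y :: real
  assumes q_pos: "q \<ge> 1" and d_pos: "d > 0" and A_pos: "A \<ge> 1"
    and rot: "real q * \<theta> - real_of_int P = - d"
    and sep: "\<And>j v. \<lbrakk>0 < j; j < int q\<rbrakk> \<Longrightarrow> real A * d < \<bar>real_of_int j * \<theta> - real_of_int v\<bar>"
    and h_Y: "h Y = real A * d"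
begin

lemma Y_pos: "Y > 0"
  using h_less_iff[of 0 Y] A_pos d_pos h_Y h_0 by simp

text \<open>In the coordinate \<open>h\<close> the interval starts at \<open>i \<theta>\<close> and
  has length \<open>A d\<close>, so an integer in it would contradict \<open>sep\<close>.\<close>

lemma iterate_avoids_int:
  assumes "1 \<le> i" "i < q" "(f ^^ i) 0 \<le> t" "t \<le> (f ^^ i) Y"
  shows "t \<notin> \<int>"
proof
  assume "t \<in> \<int>"
  then obtain m where m: "t = of_int m" by (auto elim: Ints_cases)
  have "real i * \<theta> \<le> h t" "h t \<le> real i * \<theta> + real A * d"
    using assms(3,4) h_le_iff[of "(f ^^ i) 0" t] h_le_iff[of t "(f ^^ i) Y"]
    by (simp_all add: h_funpow h_0 h_Y del: h_le_iff)
  hence "\<bar>real_of_int (int i) * \<theta> - real_of_int m\<bar> \<le> real A * d" by (simp add: m h_int)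
  thus False using sep[of "int i" m] assms by simp
qed

section \<open>Lengths and distortion along the iterates of \<open>[0, Y]\<close>\<close>

definition len :: "nat \<Rightarrow> real" where "len i = (f ^^ i) Y - (f ^^ i) 0"

lemma len_pos: "len i > 0"
  using Y_pos by (simp add: len_def)

text \<open>Translated by integers, the intervals fit into \<open>[0, 1]\<close> because none
  contains an integer. They are disjoint, since a common point of the \<open>i\<close>-th and the
  \<open>j\<close>-th would put \<open>(j - i) \<theta>\<close> within \<open>A d\<close> of an
  integer. Lebesgue measure then bounds the sum.\<close>

lemma sum_len_le_1: "(\<Sum>i=1..<q. len i) \<le> 1"
proof -
  define m where "m i = \<lfloor>(f ^^ i) 0\<rfloor>" for i
  define I where "I i = {(f ^^ i) 0 - of_int (m i)..(f ^^ i) Y - of_int (m i)}" for i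
  have sub: "I i \<subseteq> {0..1}" if "i \<in> {1..<q}" for i
  proof -
    have "\<not> of_int (m i) + 1 \<le> (f ^^ i) Y"
    proof
      assume *: "of_int (m i) + 1 \<le> (f ^^ i) Y"
      have "(f ^^ i) 0 \<le> of_int (m i) + 1" unfolding m_def by linarith
      hence "of_int (m i) + 1 \<notin> (\<int> :: real set)" using iterate_avoids_int[of i] that * by auto
      thus False by simp
    qed
    moreover have "of_int (m i) \<le> (f ^^ i) 0" unfolding m_def by linarith
    ultimately show ?thesis by (auto simp: I_def)
  qed
  have hI: "real i * \<theta> - of_int (m i) \<le> h t \<and> h t \<le> real i * \<theta> - of_int (m i) + real A * d" if "t \<in> I i" for i t
  proof -
    have "(f ^^ i) 0 \<le> t + of_int (m i)" "t + of_int (m i) \<le> (f ^^ i) Y"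
      using that by (auto simp: I_def)
    hence "h ((f ^^ i) 0) \<le> h (t + of_int (m i))" "h (t + of_int (m i)) \<le> h ((f ^^ i) Y)" by simp_all
    thus ?thesis by (simp add: h_funpow h_add_int h_0 h_Y algebra_simps)
  qed
  have disj: "I i \<inter> I j = {}" if "i < j" "i \<in> {1..<q}" "j \<in> {1..<q}" for i j
  proof (rule ccontr)
    assume "I i \<inter> I j \<noteq> {}"
    then obtain t where "t \<in> I i" "t \<in> I j" by blast
    from hI[OF this(1)] hI[OF this(2)]
    have "\<bar>(real j - real i) * \<theta> - (of_int (m j) - of_int (m i))\<bar> \<le> real A * d"
      by (simp add: algebra_simps abs_le_iff)
    moreover have "real_of_int (int (j - i)) = real j - real i" using that by simp
    ultimately have "\<bar>real_of_int (int (j - i)) * \<theta> - real_of_int (m j - m i)\<bar> \<le> real A * d" by simp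
    thus False using sep[of "int (j - i)" "m j - m i"] that by auto
  qed
  have "disjoint_family_on I {1..<q}"
    unfolding disjoint_family_on_def using disj by (metis inf_commute nat_neq_iff)
  hence "(\<Sum>i=1..<q. measure lborel (I i)) = measure lborel (\<Union>i\<in>{1..<q}. I i)"
    by (intro measure_finite_Union[symmetric]) (simp_all add: image_subset_iff I_def[abs_def] emeasure_lborel_Icc_eq)
  also have "\<dots> \<le> measure lborel {0..1::real}"
  proof (rule measure_mono_fmeasurable)
    show "(\<Union>i\<in>{1..<q}. I i) \<subseteq> {0..1}" using sub by blast
    show "(\<Union>i\<in>{1..<q}. I i) \<in> sets lborel" by (simp add: I_def)
    show "{0..1::real} \<in> fmeasurable lborel" by (rule fmeasurableI) simp_all
  qed
  also have "measure lborel {0..1::real} = 1" by simp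
  finally have "(\<Sum>i=1..<q. measure lborel (I i)) \<le> 1" .
  moreover have "measure lborel (I i) = len i" for i
  proof -
    have "(f ^^ i) 0 - of_int (m i) \<le> (f ^^ i) Y - of_int (m i)"
      using len_pos[of i] unfolding len_def by linarith
    thus ?thesis unfolding I_def len_def by (simp only: measure_lborel_Icc)
  qed
  ultimately show ?thesis by simp
qed

text \<open>The chain starts after one application of \<open>f\<close>, because
  \<open>[0, Y]\<close> contains the critical point; the later intervals avoid the integers, so each
  costs one factor of \<open>cross_ratio_distortion\<close>.\<close>

lemma iterate_cross_ratio:
  assumes C: "C \<ge> 1" "\<And>t. t \<notin> \<int> \<Longrightarrow> 2 * f' t * f''' t - 3 * (f'' t)\<^sup>2 \<le> C * (f' t)\<^sup>2"
    and small: "\<And>i. \<lbrakk>1 \<le> i; i < q\<rbrakk> \<Longrightarrow> len i \<le> 1 / (4 * C)"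
    and ord: "0 \<le> x" "x < a" "a < y" "y < b" "b \<le> Y" and n: "1 \<le> n" "n \<le> q"
  shows "cross_ratio (f x) (f a) (f y) (f b) \<le> (\<Prod>i=1..<n. 1 + C\<^sup>2 * (len i)\<^sup>2) *
    cross_ratio ((f ^^ n) x) ((f ^^ n) a) ((f ^^ n) y) ((f ^^ n) b)"
  using n
proof (induction n rule: dec_induct)
  case (step i)
  have fm: "(f ^^ i) s \<le> (f ^^ i) t" if "s \<le> t" for s t
    using that funpow_less_iff[of i s t] by (cases "s = t") (auto simp del: funpow_less_iff)
  have dist: "cross_ratio ((f ^^ i) x) ((f ^^ i) a) ((f ^^ i) y) ((f ^^ i) b) \<le> (1 + C\<^sup>2 * ((f ^^ i) Y - (f ^^ i) 0)\<^sup>2) *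
    cross_ratio (f ((f ^^ i) x)) (f ((f ^^ i) a)) (f ((f ^^ i) y)) (f ((f ^^ i) b))"
  proof (rule cross_ratio_distortion[OF C(1), where f' = f' and f'' = f'' and f''' = f'''])
    show "(f ^^ i) Y - (f ^^ i) 0 \<le> 1 / (4 * C)" using small[of i] step by (simp add: len_def)
    show "(f ^^ i) 0 \<le> (f ^^ i) x" "(f ^^ i) b \<le> (f ^^ i) Y" using fm ord by auto
    show "(f ^^ i) x < (f ^^ i) a" "(f ^^ i) a < (f ^^ i) y" "(f ^^ i) y < (f ^^ i) b" using ord by simp_all
    fix t assume t: "(f ^^ i) x \<le> t" "t \<le> (f ^^ i) b"
    have "(f ^^ i) 0 \<le> (f ^^ i) x" "(f ^^ i) b \<le> (f ^^ i) Y" using fm ord by auto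
    hence nint: "t \<notin> \<int>" using iterate_avoids_int[of i t] t step by linarith
    show "f' t > 0" using f'_pos[OF nint] .
    show "2 * f' t * f''' t - 3 * (f'' t)\<^sup>2 \<le> C * (f' t)\<^sup>2" using C(2)[OF nint] .
  qed (rule f_deriv)+
  have "cross_ratio (f x) (f a) (f y) (f b) \<le> (\<Prod>i=1..<i. 1 + C\<^sup>2 * (len i)\<^sup>2) *
    cross_ratio ((f ^^ i) x) ((f ^^ i) a) ((f ^^ i) y) ((f ^^ i) b)" using step by simp
  also have "\<dots> \<le> (\<Prod>i=1..<i. 1 + C\<^sup>2 * (len i)\<^sup>2) * ((1 + C\<^sup>2 * (len i)\<^sup>2) *
    cross_ratio ((f ^^ Suc i) x) ((f ^^ Suc i) a) ((f ^^ Suc i) y) ((f ^^ Suc i) b))"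
    using dist by (intro mult_left_mono prod_nonneg) (auto simp: len_def)
  also have "\<dots> = (\<Prod>i=1..<Suc i. 1 + C\<^sup>2 * (len i)\<^sup>2) *
    cross_ratio ((f ^^ Suc i) x) ((f ^^ Suc i) a) ((f ^^ Suc i) y) ((f ^^ Suc i) b)"
    using step by (simp add: prod.atLeastLessThan_Suc mult_ac)
  finally show ?case .
qed simp

text \<open>The sum of the squared lengths is at most the largest length times the total length,
  hence at most \<open>\<epsilon>\<close>. For \<open>q = 1\<close> the condition on
  \<open>\<epsilon>\<close> is void, whence the absolute value.\<close>

lemma prod_distortion_le:
  assumes small: "\<And>i. \<lbrakk>1 \<le> i; i < q\<rbrakk> \<Longrightarrow> len i \<le> \<epsilon>"
  shows "(\<Prod>i=1..<q. 1 + C\<^sup>2 * (len i)\<^sup>2) \<le> exp (C\<^sup>2 * \<bar>\<epsilon>\<bar>)"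
proof -
  have "(\<Prod>i=1..<q. 1 + C\<^sup>2 * (len i)\<^sup>2) \<le> (\<Prod>i=1..<q. exp (C\<^sup>2 * \<bar>\<epsilon>\<bar> * len i))"
  proof (rule prod_mono)
    fix i assume i: "i \<in> {1..<q}"
    have "(len i)\<^sup>2 \<le> \<bar>\<epsilon>\<bar> * len i"
      using small[of i] i len_pos[of i] by (simp add: power2_eq_square)
    hence "C\<^sup>2 * (len i)\<^sup>2 \<le> C\<^sup>2 * \<bar>\<epsilon>\<bar> * len i" by (simp add: mult_left_mono mult.assoc)
    also have "1 + \<dots> \<le> exp (C\<^sup>2 * \<bar>\<epsilon>\<bar> * len i)" by (rule exp_ge_add_one_self)
    finally show "0 \<le> 1 + C\<^sup>2 * (len i)\<^sup>2 \<and> 1 + C\<^sup>2 * (len i)\<^sup>2 \<le> exp (C\<^sup>2 * \<bar>\<epsilon>\<bar> * len i)"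
      by (simp add: add_nonneg_nonneg)
  qed
  also have "\<dots> = exp (C\<^sup>2 * \<bar>\<epsilon>\<bar> * (\<Sum>i=1..<q. len i))"
    by (simp add: exp_sum sum_distrib_left)
  also have "\<dots> \<le> exp (C\<^sup>2 * \<bar>\<epsilon>\<bar> * 1)"
    using sum_len_le_1 by (simp only: exp_le_cancel_iff) (intro mult_left_mono; simp)
  finally show ?thesis by simp
qed

section \<open>The return map\<close>

definition ret :: "real \<Rightarrow> real" where "ret x = (f ^^ q) x - of_int P"

lemma h_ret: "h (ret x) = h x - d"
  using rot by (simp add: ret_def h_diff_int h_funpow algebra_simps)

lemma ret_less: "ret x < x"
  using h_less_iff[of "ret x" x] h_ret d_pos by simp

lemma ret_less_iff [simp]: "ret x < ret y \<longleftrightarrow> x < y"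
  by (simp add: ret_def)

text \<open>Since \<open>ret\<close> expands cross-ratios by a definite amount, it cannot be close to the identity at
  two points that are far apart.\<close>
lemma bottleneck:
  assumes expand: "\<And>x a y b. \<lbrakk>0 < x; x < a; a < y; y < b; b \<le> Y\<rbrakk> \<Longrightarrow>
      (1 + (b - a) * (y - x) / ((a + x) * (b + y))) * cross_ratio x a y b
        \<le> 1001/1000 * cross_ratio (ret x) (ret a) (ret y) (ret b)"
    and ab: "Y / 8 \<le> a" "b \<le> Y" "a - ret a \<le> Y / 10^7" "b - ret b \<le> Y / 10^7"
  shows "b - a < Y / 8"
proof (rule ccontr)
  assume far: "\<not> b - a < Y / 8"
  \<comment> \<open>The outer gaps have length \<open>Y / 16\<close>: \<open>Y / 8 \<le> a\<close>
    keeps \<open>x\<close> positive, and \<open>b - a \<ge> Y / 8\<close> keeps \<open>y\<close> to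
    the right of \<open>a\<close>.\<close>
  define x where "x = a - Y / 16"
  define y where "y = b - Y / 16"
  define D where "D = (b - a) / Y"
  have D: "1/8 \<le> D" "D \<le> 1" "b - a = D * Y"
    using far ab Y_pos by (simp_all add: D_def pos_le_divide_eq pos_divide_le_eq)
  have ord: "0 < x" "x < a" "a < y" "y < b"
    using ab far Y_pos by (simp_all add: x_def y_def)
  have yx: "y - x = D * Y" using D by (simp add: x_def y_def)
  have "D * Y * (D * Y) / (4 * Y * Y) \<le> (b - a) * (y - x) / ((a + x) * (b + y))"
  proof -
    have "(a + x) * (b + y) \<le> (2 * Y) * (2 * Y)"
      using ord ab Y_pos by (intro mult_mono) auto
    thus ?thesis unfolding D(3) yx using ord D Y_pos by (intro divide_left_mono) auto
  qed
  moreover have "D * Y * (D * Y) / (4 * Y * Y) = D\<^sup>2 / 4" using Y_pos by (simp add: power2_eq_square)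
  moreover have "1/8 * (1/8) \<le> D * D" using D by (intro mult_mono) auto
  ultimately have gain: "1/256 \<le> (b - a) * (y - x) / ((a + x) * (b + y))"
    unfolding power2_eq_square by linarith
  have "cross_ratio x a y b = (D * Y - Y / 16) * (D * Y + Y / 16) / (Y / 16 * (Y / 16))"
    using D(3) by (simp add: cross_ratio_def x_def y_def algebra_simps)
  also have "\<dots> = (16 * D)\<^sup>2 - 1"
    using Y_pos by (simp add: field_simps power2_eq_square)
  finally have cr: "cross_ratio x a y b = (16 * D)\<^sup>2 - 1" .
  define W where "W = ret b - ret a"
  define \<alpha> where "\<alpha> = ret a - ret x"
  define \<beta> where "\<beta> = ret b - ret y"
  define s where "s = (1/16 - 1/10^7) * Y"
  have s: "s > 0" using Y_pos by (simp add: s_def)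
  have \<alpha>: "s \<le> \<alpha>" using ret_less[of x] ab by (simp add: \<alpha>_def s_def x_def algebra_simps)
  have \<beta>: "s \<le> \<beta>" using ret_less[of y] ab by (simp add: \<beta>_def s_def y_def algebra_simps)
  have W: "W \<le> (D + 1/10^7) * Y" using ret_less[of b] ab D(3) by (simp add: W_def algebra_simps)
  have W\<beta>: "\<beta> < W" using ord ret_less_iff[of a y] by (simp add: W_def \<beta>_def del: ret_less_iff)
  have r: "W / t \<le> (D + 1/10^7) / (1/16 - 1/10^7)" if "s \<le> t" for t
  proof -
    have "W / t \<le> (D + 1/10^7) * Y / s" using W W\<beta> \<beta> s that by (intro frac_le) auto
    thus ?thesis using Y_pos by (simp add: s_def)
  qed
  have "cross_ratio (ret x) (ret a) (ret y) (ret b) = (W - \<beta>) * (W + \<alpha>) / (\<alpha> * \<beta>)"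
    by (simp add: cross_ratio_def W_def \<alpha>_def \<beta>_def)
  \<comment> \<open>Increasing in both quotients, so an upper bound for \<open>W\<close> and lower
    bounds for \<open>\<alpha>\<close> and \<open>\<beta>\<close> suffice: \<open>ret\<close> moves
    every point to the left, and moves \<open>a\<close> and \<open>b\<close> only slightly.\<close>
  also have "\<dots> = (W / \<beta> - 1) * (W / \<alpha> + 1)" using \<alpha> \<beta> s by (simp add: field_simps)
  also have "\<dots> \<le> ((D + 1/10^7) / (1/16 - 1/10^7) - 1) * ((D + 1/10^7) / (1/16 - 1/10^7) + 1)"
  proof (rule mult_mono)
    show "W / \<beta> - 1 \<le> (D + 1/10^7) / (1/16 - 1/10^7) - 1" "W / \<alpha> + 1 \<le> (D + 1/10^7) / (1/16 - 1/10^7) + 1"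
      using r \<alpha> \<beta> by simp_all
    have "1 \<le> W / \<beta>" using W\<beta> \<beta> s by simp
    thus "0 \<le> (D + 1/10^7) / (1/16 - 1/10^7) - 1" using r[OF \<beta>] by linarith
    have "0 \<le> W / \<alpha>" using W\<beta> \<beta> \<alpha> s by simp
    thus "0 \<le> W / \<alpha> + 1" by linarith
  qed
  also have "\<dots> = ((D + 1/10^7) / (1/16 - 1/10^7))\<^sup>2 - 1"
    by (simp only: power2_eq_square) (simp add: algebra_simps)
  finally have crR: "cross_ratio (ret x) (ret a) (ret y) (ret b)
      \<le> ((D + 1/10^7) / (1/16 - 1/10^7))\<^sup>2 - 1" .
  have "(1 + 1/256) * cross_ratio x a y b \<le> (1 + (b - a) * (y - x) / ((a + x) * (b + y))) * cross_ratio x a y b"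
    using gain cross_ratio_pos[OF ord(2-4)] by (intro mult_right_mono) auto
  also have "\<dots> \<le> 1001/1000 * cross_ratio (ret x) (ret a) (ret y) (ret b)"
    using expand[OF ord ab(2)] .
  also have "\<dots> \<le> 1001/1000 * (((D + 1/10^7) / (1/16 - 1/10^7))\<^sup>2 - 1)"
    using crR by simp
  also have "\<dots> < (1 + 1/256) * ((16 * D)\<^sup>2 - 1)" by (rule bottleneck_numeric[OF D(1,2)])
  finally show False unfolding cr by simp
qed

end

section \<open>Quasisymmetry and the bound obtained from one return\<close>

definition pair_bound :: "(real \<Rightarrow> real) \<Rightarrow> real \<Rightarrow> bool" where
  "pair_bound g K \<longleftrightarrow> (\<forall>x t. 0 < t \<longrightarrow> g (x + t) - g x \<le> K * (g x - g (x - t)) \<and>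
     g x - g (x - t) \<le> K * (g (x + t) - g x))"

lemma pair_boundD:
  assumes "pair_bound g K" "u < v" "w - v = v - u"
  shows "g w - g v \<le> K * (g v - g u)" "g v - g u \<le> K * (g w - g v)"
proof -
  have "v + (v - u) = w" "v - (v - u) = u" using assms by simp_all
  thus "g w - g v \<le> K * (g v - g u)" "g v - g u \<le> K * (g w - g v)"
    using assms(1,2) unfolding pair_bound_def by (metis diff_gt_0_iff_gt)+
qed

text \<open>Only \<open>h\<close> and \<open>\<theta>\<close> occur, so the same predicate serves
  the reflected data. The function \<open>g\<close> stands for an interpolant agreeing with
  \<open>h\<close> at the points \<open>k d\<close> of the linearizing coordinate.\<close>

definition return_bound :: "(real \<Rightarrow> real) \<Rightarrow> real \<Rightarrow> real \<Rightarrow> bool" where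
  "return_bound h \<theta> \<delta> \<longleftrightarrow> (\<forall>q P d A g K. q \<ge> 1 \<longrightarrow> d > 0 \<longrightarrow> A \<ge> 1 \<longrightarrow>
     real q * \<theta> - real_of_int P = - d \<longrightarrow>
     (\<forall>j v. 0 < j \<longrightarrow> j < int q \<longrightarrow> real A * d < \<bar>real_of_int j * \<theta> - real_of_int v\<bar>) \<longrightarrow>
     real A * d < \<delta> \<longrightarrow> mono g \<longrightarrow> (\<forall>k z. k \<le> A \<longrightarrow> h z = real k * d \<longrightarrow> g z = real k * d) \<longrightarrow>
     K \<ge> 1 \<longrightarrow> pair_bound g K \<longrightarrow> real A \<le> 4 * (10^7 + 2) * K)"

context critical_lift
begin

text \<open>All the intervals \<open>f^i([0, Y])\<close> have length \<open>A d\<close> in the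
  coordinate \<open>h\<close>. A small \<open>\<delta>\<close> thus makes them all short, and the
  distortion of the iterates after the first costs at most \<open>1001/1000\<close>.\<close>

lemma return_expands:
  "\<exists>\<delta>>0. \<forall>q P d A Y. critical_return f f' f'' f''' h \<theta> q P d A Y \<and> real A * d < \<delta> \<longrightarrow>
     (\<forall>x a y b. 0 < x \<and> x < a \<and> a < y \<and> y < b \<and> b \<le> Y \<longrightarrow>
       (1 + (b - a) * (y - x) / ((a + x) * (b + y))) * cross_ratio x a y b
       \<le> 1001/1000 * cross_ratio ((f ^^ q) x - of_int P) ((f ^^ q) a - of_int P)
           ((f ^^ q) y - of_int P) ((f ^^ q) b - of_int P))"
proof -
  obtain C0 where C0: "\<And>t. t \<notin> \<int> \<Longrightarrow> 2 * f' t * f''' t - 3 * (f'' t)\<^sup>2 \<le> C0 * (f' t)\<^sup>2"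
    using schwarz_bdd by blast
  define C where "C = max 1 C0"
  have C1: "C \<ge> 1" by (simp add: C_def)
  have C: "2 * f' t * f''' t - 3 * (f'' t)\<^sup>2 \<le> C * (f' t)\<^sup>2" if "t \<notin> \<int>" for t
  proof -
    have "C0 * (f' t)\<^sup>2 \<le> C * (f' t)\<^sup>2" by (intro mult_right_mono) (auto simp: C_def)
    thus ?thesis using C0[OF that] by linarith
  qed
  obtain \<rho> where \<rho>: "\<rho> > 0" "\<And>t. \<lbrakk>0 < \<bar>t\<bar>; \<bar>t\<bar> < \<rho>\<rbrakk> \<Longrightarrow>
      2 * f' t * f''' t - 3 * (f'' t)\<^sup>2 \<le> - 3 / t\<^sup>2 * (f' t)\<^sup>2"
    using schwarz_near by blast
  \<comment> \<open>The four bounds, in order: the estimate at the critical point applies, no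
    further integer is met, \<open>cross_ratio_distortion\<close> applies, and the product of its
    factors is at most \<open>1001/1000\<close>.\<close>
  define \<epsilon> where "\<epsilon> = min (min \<rho> 1) (min (1 / (4 * C)) (ln (1001/1000) / C\<^sup>2))"
  have \<epsilon>: "\<epsilon> > 0" "\<epsilon> \<le> \<rho>" "\<epsilon> \<le> 1" "\<epsilon> \<le> 1 / (4 * C)" "\<epsilon> \<le> ln (1001/1000) / C\<^sup>2"
    using \<rho>(1) C1 by (auto simp: \<epsilon>_def)
  obtain \<delta> where \<delta>: "\<delta> > 0" "\<And>u v. h v - h u < \<delta> \<Longrightarrow> v - u < \<epsilon>"
    using small_if_h_small[OF \<epsilon>(1)] by blast
  show ?thesis
  proof (intro exI[of _ \<delta>] conjI allI impI \<delta>(1), elim conjE)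
    fix q P d A Y x a y b
    assume "critical_return f f' f'' f''' h \<theta> q P d A Y" and small: "real A * d < \<delta>"
      and ord: "0 < x" "x < a" "a < y" "y < b" "b \<le> Y"
    interpret critical_return f f' f'' f''' h \<theta> q P d A Y by fact
    have len: "len i < \<epsilon>" for i
      unfolding len_def using \<delta>(2)[of "(f ^^ i) Y" "(f ^^ i) 0"] small by (simp add: h_funpow h_0 h_Y)
    have Y: "Y < \<epsilon>" using \<delta>(2)[of Y 0] small by (simp add: h_0 h_Y)
    have "(1 + (b - a) * (y - x) / ((a + x) * (b + y))) * cross_ratio x a y b
        \<le> cross_ratio (f x) (f a) (f y) (f b)"
    proof (rule cross_ratio_expand_near_critical[OF ord(1-4), where f' = f' and f'' = f'' and f''' = f'''])
      fix t assume t: "x \<le> t" "t \<le> b"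
      hence "0 < t" "t < \<epsilon>" using ord Y by auto
      hence "t \<notin> \<int>" using \<epsilon>(3) by (auto elim!: Ints_cases)
      thus "f' t > 0" by (rule f'_pos)
      show "2 * f' t * f''' t - 3 * (f'' t)\<^sup>2 \<le> - 3 / t\<^sup>2 * (f' t)\<^sup>2"
        using \<rho>(2)[of t] \<open>0 < t\<close> \<open>t < \<epsilon>\<close> \<epsilon>(2) by simp
    qed (rule f_deriv)+
    also have "\<dots> \<le> (\<Prod>i=1..<q. 1 + C\<^sup>2 * (len i)\<^sup>2) *
        cross_ratio ((f ^^ q) x) ((f ^^ q) a) ((f ^^ q) y) ((f ^^ q) b)"
      using len \<epsilon> ord q_pos C1 C
      by (intro iterate_cross_ratio) (auto intro: less_imp_le order.strict_trans2)
    also have "\<dots> \<le> 1001/1000 * cross_ratio ((f ^^ q) x) ((f ^^ q) a) ((f ^^ q) y) ((f ^^ q) b)"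
    proof (rule mult_right_mono)
      have "(\<Prod>i=1..<q. 1 + C\<^sup>2 * (len i)\<^sup>2) \<le> exp (C\<^sup>2 * \<bar>\<epsilon>\<bar>)"
        using len by (intro prod_distortion_le) (simp add: less_imp_le)
      also have "exp (C\<^sup>2 * \<bar>\<epsilon>\<bar>) \<le> exp (ln (1001/1000))"
      proof (subst exp_le_cancel_iff)
        have "C\<^sup>2 * \<bar>\<epsilon>\<bar> \<le> C\<^sup>2 * (ln (1001/1000) / C\<^sup>2)"
          using \<epsilon> by (intro mult_left_mono) auto
        thus "C\<^sup>2 * \<bar>\<epsilon>\<bar> \<le> ln (1001/1000)" using C1 by simp
      qed
      finally show "(\<Prod>i=1..<q. 1 + C\<^sup>2 * (len i)\<^sup>2) \<le> 1001/1000" by simp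
      show "0 \<le> cross_ratio ((f ^^ q) x) ((f ^^ q) a) ((f ^^ q) y) ((f ^^ q) b)"
        using ord by (intro less_imp_le cross_ratio_pos) simp_all
    qed
    finally show "(1 + (b - a) * (y - x) / ((a + x) * (b + y))) * cross_ratio x a y b
       \<le> 1001/1000 * cross_ratio ((f ^^ q) x - of_int P) ((f ^^ q) a - of_int P)
           ((f ^^ q) y - of_int P) ((f ^^ q) b - of_int P)"
      by (simp only: cross_ratio_translate)
  qed
qed

end

context critical_return
begin

section \<open>The backward orbit of 0 under the return map\<close>

definition pt :: "nat \<Rightarrow> real" where "pt k = inv h (real k * d)"

lemma h_pt: "h (pt k) = real k * d"
  by (simp add: pt_def surj_f_inv_f[OF h_surj])

lemma pt_unique: "h z = real k * d \<Longrightarrow> z = pt k"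
  using h_eq_iff[of z "pt k"] h_pt by simp

lemma pt_less_iff: "pt j < pt k \<longleftrightarrow> j < k"
  using h_less_iff[of "pt j" "pt k"] d_pos by (simp add: h_pt del: h_less_iff)

lemma pt_0: "pt 0 = 0" and pt_A: "pt A = Y"
  using pt_unique[of 0 0] pt_unique[of Y A] by (auto simp: h_0 h_Y)

lemma ret_pt: "ret (pt (Suc k)) = pt k"
  by (rule pt_unique) (simp add: h_ret h_pt algebra_simps)

text \<open>The steps from \<open>pt (k - 1)\<close> to \<open>pt k\<close> fill
  \<open>[0, Y]\<close> without overlap.\<close>

lemma few_long_steps:
  assumes "S \<subseteq> {1..A}" and "\<And>k. k \<in> S \<Longrightarrow> Y / 10^7 < pt k - ret (pt k)"
  shows "real (card S) \<le> 10^7"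
proof -
  have fin: "finite S" using assms(1) finite_subset by blast
  have "real (card S) * (Y / 10^7) = (\<Sum>k\<in>S. Y / 10^7)" by simp
  also have "\<dots> \<le> (\<Sum>k\<in>S. pt k - ret (pt k))" using assms by (intro sum_mono) (auto intro: less_imp_le)
  also have "\<dots> \<le> (\<Sum>k\<in>{1..A}. pt k - ret (pt k))"
    using assms(1) ret_less by (intro sum_mono2) (auto intro: less_imp_le)
  also have "\<dots> = (\<Sum>k=Suc 0..A. pt k - pt (k - 1))"
  proof (intro sum.cong)
    fix k assume "k \<in> {Suc 0..A}"
    thus "pt k - ret (pt k) = pt k - pt (k - 1)" using ret_pt[of "k - 1"] by simp
  qed simp
  also have "\<dots> = Y" by (subst sum_telescope'') (auto simp: pt_0 pt_A)
  finally show ?thesis using Y_pos by (simp add: field_simps)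
qed

text \<open>Between consecutive points \<open>g\<close> grows by \<open>d\<close>. Each point in
  \<open>(u, v]\<close> accounts for one \<open>d\<close>, and the incomplete cells at the two ends
  add at most one more.\<close>

lemma mass_le:
  assumes g: "mono g" "\<And>k. k \<le> A \<Longrightarrow> g (pt k) = real k * d"
    and uv: "0 \<le> u" "u \<le> v" "v \<le> Y"
    and m: "real (card {k \<in> {1..A}. u < pt k \<and> pt k \<le> v}) \<le> m"
  shows "g v - g u \<le> (m + 1) * d"
proof -
  define i where "i = Max {k. k \<le> A \<and> pt k \<le> u}"
  define j where "j = Max {k. k \<le> A \<and> pt k \<le> v}"
  have i: "i \<le> A" "pt i \<le> u" "\<And>k. \<lbrakk>k \<le> A; pt k \<le> u\<rbrakk> \<Longrightarrow> k \<le> i"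
  proof -
    have "finite {k. k \<le> A \<and> pt k \<le> u}" "0 \<in> {k. k \<le> A \<and> pt k \<le> u}" using pt_0 uv by auto
    hence "i \<in> {k. k \<le> A \<and> pt k \<le> u}" "\<And>k. k \<in> {k. k \<le> A \<and> pt k \<le> u} \<Longrightarrow> k \<le> i"
      unfolding i_def using Max_in by (blast, simp)
    thus "i \<le> A" "pt i \<le> u" "\<And>k. \<lbrakk>k \<le> A; pt k \<le> u\<rbrakk> \<Longrightarrow> k \<le> i" by blast+
  qed
  have j: "j \<le> A" "pt j \<le> v" "\<And>k. \<lbrakk>k \<le> A; pt k \<le> v\<rbrakk> \<Longrightarrow> k \<le> j"
  proof -
    have "finite {k. k \<le> A \<and> pt k \<le> v}" "0 \<in> {k. k \<le> A \<and> pt k \<le> v}" using pt_0 uv by auto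
    hence "j \<in> {k. k \<le> A \<and> pt k \<le> v}" "\<And>k. k \<in> {k. k \<le> A \<and> pt k \<le> v} \<Longrightarrow> k \<le> j"
      unfolding j_def using Max_in by (blast, simp)
    thus "j \<le> A" "pt j \<le> v" "\<And>k. \<lbrakk>k \<le> A; pt k \<le> v\<rbrakk> \<Longrightarrow> k \<le> j" by blast+
  qed
  have ij: "i \<le> j" using i(1,2) j(3)[of i] uv by simp
  have "{Suc i..j} \<subseteq> {k \<in> {1..A}. u < pt k \<and> pt k \<le> v}"
  proof
    fix k assume k: "k \<in> {Suc i..j}"
    hence "pt k \<le> pt j" using pt_less_iff[of j k] by (simp add: not_less[symmetric])
    moreover have "u < pt k" using i(3)[of k] k j(1) by fastforce
    ultimately show "k \<in> {k \<in> {1..A}. u < pt k \<and> pt k \<le> v}" using k j(1,2) by auto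
  qed
  hence "card {Suc i..j} \<le> card {k \<in> {1..A}. u < pt k \<and> pt k \<le> v}" by (intro card_mono) auto
  hence jm: "real j - real i \<le> m" using m ij by simp
  have "g v \<le> (real j + 1) * d"
  proof (cases "j = A")
    case True
    hence "g v \<le> g (pt A)" using uv pt_A g(1) by (auto intro: monoD)
    thus ?thesis using g(2)[of A] d_pos True by (simp add: algebra_simps)
  next
    case False
    hence "v \<le> pt (Suc j)" using j(3)[of "Suc j"] j(1) by fastforce
    hence "g v \<le> g (pt (Suc j))" using g(1) by (auto intro: monoD)
    thus ?thesis using g(2)[of "Suc j"] False j(1) by (simp add: add.commute)
  qed
  moreover have "real i * d \<le> g u" using monoD[OF g(1) i(2)] g(2)[OF i(1)] by simp
  ultimately have "g v - g u \<le> (real j - real i + 1) * d" by (simp add: algebra_simps)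
  also have "\<dots> \<le> (m + 1) * d" using jm d_pos by (intro mult_right_mono) auto
  finally show ?thesis .
qed

text \<open>At most \<open>10\<^sup>7\<close> of the points in \<open>[Y/8, Y]\<close> lie outside \<open>[p, p + Y/8]\<close>, because their steps are longer
  than \<open>Y/10\<^sup>7\<close>. If \<open>p \<le> 3Y/8\<close>, compare \<open>[0, Y/2]\<close> with \<open>[Y/2, Y]\<close>; otherwise compare \<open>[0, Y/8]\<close> and
  \<open>[p, p + Y/8]\<close> with \<open>[Y/8, Y/4]\<close> and \<open>[p - Y/8, p]\<close>.\<close>
lemma partial_quotient_le:
  assumes expand: "\<And>x a y b. \<lbrakk>0 < x; x < a; a < y; y < b; b \<le> Y\<rbrakk> \<Longrightarrow>
      (1 + (b - a) * (y - x) / ((a + x) * (b + y))) * cross_ratio x a y b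
        \<le> 1001/1000 * cross_ratio (ret x) (ret a) (ret y) (ret b)"
    and g: "mono g" "\<And>k. k \<le> A \<Longrightarrow> g (pt k) = real k * d"
    and K: "K \<ge> 1" "pair_bound g K"
  shows "real A \<le> 4 * (10^7 + 2) * K"
proof -
  define S where "S = {k \<in> {1..A}. Y / 8 \<le> pt k \<and> pt k - ret (pt k) \<le> Y / 10^7}"
  obtain p where p: "Y / 8 \<le> p" "p \<le> Y" "\<And>k. k \<in> S \<Longrightarrow> p \<le> pt k \<and> pt k < p + Y / 8"
  proof (cases "S = {}")
    case True
    \<comment> \<open>Without a short step in \<open>[Y/8, Y]\<close> the choice of \<open>p\<close>
      is free.\<close>
    thus ?thesis using that[of Y] Y_pos by simp
  next
    case False
    define p where "p = Min (pt ` S)"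
    have "finite S" by (simp add: S_def)
    hence "p \<in> pt ` S" "\<And>k. k \<in> S \<Longrightarrow> p \<le> pt k" using False by (auto simp: p_def)
    then obtain k0 where k0: "k0 \<in> S" "p = pt k0" by blast
    have le: "pt k \<le> Y" if "k \<in> S" for k
      using that pt_less_iff[of A k] pt_A by (auto simp: S_def not_less[symmetric])
    have "pt k < p + Y / 8" if "k \<in> S" for k
      using bottleneck[OF expand, of "pt k0" "pt k"] that k0 le by (auto simp: S_def)
    thus ?thesis using that[of p] \<open>\<And>k. k \<in> S \<Longrightarrow> p \<le> pt k\<close> k0 le by (auto simp: S_def)
  qed
  \<comment> \<open>At most \<open>10^7\<close> points with long steps, at most one further point,
    namely \<open>p\<close> itself, and one extra cell from \<open>mass_le\<close>.\<close>
  define B :: real where "B = 10^7 + 2"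
  have few: "g v - g u \<le> B * d" if uv: "Y / 8 \<le> u" "u \<le> v" "v \<le> Y" and "v \<le> p \<or> p + Y / 8 \<le> u" for u v
  proof -
    define T where "T = {k \<in> {1..A}. u < pt k \<and> pt k \<le> v}"
    have "inj pt" using pt_less_iff by (metis injI linorder_neqE_nat less_irrefl)
    moreover have "pt k = p" if "k \<in> T \<inter> S" for k
      using that p(3)[of k] \<open>v \<le> p \<or> p + Y / 8 \<le> u\<close> unfolding T_def by auto
    ultimately have "T \<inter> S \<subseteq> {inv pt p}" by (metis inv_f_eq singletonI subsetI)
    hence "card (T \<inter> S) \<le> card {inv pt p}" by (intro card_mono) auto
    hence "card (T \<inter> S) \<le> 1" by simp
    have "real (card (T - S)) \<le> 10^7"
      using uv Y_pos by (intro few_long_steps) (auto simp: T_def S_def)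
    moreover have "card T \<le> card (T - S) + card (T \<inter> S)"
      by (metis Un_Diff_Int card_Un_le)
    ultimately have "real (card T) \<le> 10^7 + 1" using \<open>card (T \<inter> S) \<le> 1\<close> by linarith
    thus ?thesis using mass_le[OF g, of u v "10^7 + 1"] uv Y_pos by (simp add: T_def B_def)
  qed
  have gY: "g Y = real A * d" and g0: "g 0 = 0"
    using g(2)[of A] g(2)[of 0] by (simp_all add: pt_A pt_0)
  note pb = pair_boundD[OF K(2)]
  have Bd: "B * d \<ge> 0" using d_pos by (simp add: B_def)
  have KB: "B * d \<le> K * (B * d)" using mult_right_mono[OF K(1) Bd] by simp
  have scale: "K * s \<le> K * (B * d)" if "s \<le> B * d" for s using that K(1) by (intro mult_left_mono) auto
  have "real A * d \<le> 4 * (K * (B * d))"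
  proof (cases "p \<le> 3/8 * Y")
    case True
    have "g Y - g (Y / 2) \<le> B * d" using True Y_pos by (intro few) auto
    moreover have "g (Y / 2) - g 0 \<le> K * (g Y - g (Y / 2))" using Y_pos by (intro pb(2)) auto
    ultimately show ?thesis using gY g0 KB scale[of "g Y - g (Y / 2)"] Bd by linarith
  next
    case False
    \<comment> \<open>The points \<open>Y/8\<close>, \<open>p\<close> and \<open>p + Y/8\<close> cut
      \<open>[0, Y]\<close> into four pieces. The second and the last carry at most
      \<open>B d\<close>; the other two are bounded through an adjacent interval of the same length
      that carries at most \<open>B d\<close>.\<close>
    have 1: "g (Y / 8) - g 0 \<le> K * (g (Y / 4) - g (Y / 8))" using Y_pos by (intro pb(2)) auto
    have 2: "g (Y / 4) - g (Y / 8) \<le> B * d" using False Y_pos p(2) by (intro few) auto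
    have 3: "g p - g (Y / 8) \<le> B * d" using False Y_pos p(2) by (intro few) auto
    have 4: "g (p + Y / 8) - g p \<le> K * (g p - g (p - Y / 8))" using Y_pos by (intro pb(1)) auto
    have 5: "g p - g (p - Y / 8) \<le> B * d" using False Y_pos p(2) by (intro few) auto
    have 6: "g Y - g (p + Y / 8) \<le> B * d"
    proof (cases "p + Y / 8 \<le> Y")
      case True
      thus ?thesis using p(1) Y_pos by (intro few) auto
    next
      case False
      thus ?thesis using monoD[OF g(1), of Y "p + Y / 8"] Bd by simp
    qed
    show ?thesis using 1 3 4 6 scale[OF 2] scale[OF 5] KB gY g0 by linarith
  qed
  hence "real A * d \<le> (4 * B * K) * d" by (simp add: mult_ac)
  thus ?thesis using d_pos by (simp add: B_def)
qed

end

context critical_lift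
begin

lemma ex_return_bound: "\<exists>\<delta>>0. return_bound h \<theta> \<delta>"
proof -
  obtain \<delta> where \<delta>: "\<delta> > 0" and expand: "\<And>q P d A Y x a y b.
     \<lbrakk>critical_return f f' f'' f''' h \<theta> q P d A Y; real A * d < \<delta>;
       0 < x; x < a; a < y; y < b; b \<le> Y\<rbrakk> \<Longrightarrow>
       (1 + (b - a) * (y - x) / ((a + x) * (b + y))) * cross_ratio x a y b
       \<le> 1001/1000 * cross_ratio ((f ^^ q) x - of_int P) ((f ^^ q) a - of_int P)
           ((f ^^ q) y - of_int P) ((f ^^ q) b - of_int P)"
    using return_expands by blast
  show ?thesis
  unfolding return_bound_def
  proof (intro exI[of _ \<delta>] conjI allI impI \<delta>)
    fix q P d A g K
    assume *: "q \<ge> 1" "d > 0" "A \<ge> 1" "real q * \<theta> - real_of_int P = - d"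
      "\<forall>j v. 0 < j \<longrightarrow> j < int q \<longrightarrow> real A * d < \<bar>real_of_int j * \<theta> - real_of_int v\<bar>"
      "real A * d < \<delta>" "mono g" "\<forall>k z. k \<le> A \<longrightarrow> h z = real k * d \<longrightarrow> g z = real k * d"
      "K \<ge> 1" "pair_bound g K"
    define Y where "Y = inv h (real A * d)"
    interpret critical_return f f' f'' f''' h \<theta> q P d A Y
      by unfold_locales (use * in \<open>auto simp: Y_def surj_f_inv_f[OF h_surj]\<close>)
    show "real A \<le> 4 * (10^7 + 2) * K"
    proof (rule partial_quotient_le)
      show "(1 + (b - a) * (y - x) / ((a + x) * (b + y))) * cross_ratio x a y b
        \<le> 1001/1000 * cross_ratio (ret x) (ret a) (ret y) (ret b)"
        if "0 < x" "x < a" "a < y" "y < b" "b \<le> Y" for x a y b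
        unfolding ret_def using that *(6) by (intro expand) unfold_locales
      show "g (pt k) = real k * d" if "k \<le> A" for k using *(8) that h_pt by blast
    qed (use * in auto)
  qed
qed

end

text \<open>The reflection serves the returns with \<open>q \<theta> - p > 0\<close>, whose backward orbit of \<open>0\<close> lies to the left
  of \<open>0\<close>.\<close>
lemma critical_lift_reflect:
  assumes "critical_lift f f' f'' f''' h \<theta>"
  shows "critical_lift (\<lambda>x. - f (- x)) (\<lambda>x. f' (- x)) (\<lambda>x. - f'' (- x)) (\<lambda>x. f''' (- x))
    (\<lambda>x. - h (- x)) (- \<theta>)"
proof -
  interpret critical_lift f f' f'' f''' h \<theta> by fact
  show ?thesis
  proof
    show "strict_mono (\<lambda>x. - h (- x))" by (intro strict_monoI) simp
    show "surj (\<lambda>x. - h (- x))"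
      by (metis (no_types, lifting) add.inverse_inverse h_surj surj_def)
    show "- h (- 0) = 0" by (simp add: h_0)
    show "- h (- (x + 1)) = - h (- x) + 1" for x
      using h_plus_1[of "- x - 1"] by simp
    show "- h (- (- f (- x))) = - h (- x) + - \<theta>" for x by (simp add: h_conj)
    have m: "((\<lambda>x. g (- x)) has_real_derivative - g') (at x)"
      if "(g has_real_derivative g') (at (- x))" for g g' x
      using that DERIV_mirror by blast
    show "((\<lambda>x. - f (- x)) has_real_derivative f' (- x)) (at x)" for x
      using DERIV_minus[OF m[OF f_deriv(1)]] by simp
    show "((\<lambda>x. f' (- x)) has_real_derivative - f'' (- x)) (at x)" for x
      using m[OF f_deriv(2)] .
    show "((\<lambda>x. - f'' (- x)) has_real_derivative f''' (- x)) (at x)" for x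
      using DERIV_minus[OF m[OF f_deriv(3)]] by simp
    show "f' (- x) > 0" if "x \<notin> \<int>" for x using f'_pos[of "- x"] that by simp
    obtain \<delta> where \<delta>: "\<delta> > 0" "\<And>t. \<lbrakk>0 < \<bar>t\<bar>; \<bar>t\<bar> < \<delta>\<rbrakk> \<Longrightarrow>
      2 * f' t * f''' t - 3 * (f'' t)\<^sup>2 \<le> - 3 / t\<^sup>2 * (f' t)\<^sup>2"
      using schwarz_near by blast
    show "\<exists>\<delta>>0. \<forall>t. 0 < \<bar>t\<bar> \<and> \<bar>t\<bar> < \<delta> \<longrightarrow>
      2 * f' (- t) * f''' (- t) - 3 * (- f'' (- t))\<^sup>2 \<le> - 3 / t\<^sup>2 * (f' (- t))\<^sup>2"
      using \<delta>(2)[of "- t" for t] by (intro exI[of _ \<delta>] conjI \<delta>(1)) simp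
    obtain C where C: "\<And>t. t \<notin> \<int> \<Longrightarrow> 2 * f' t * f''' t - 3 * (f'' t)\<^sup>2 \<le> C * (f' t)\<^sup>2"
      using schwarz_bdd by blast
    show "\<exists>C. \<forall>t. t \<notin> \<int> \<longrightarrow> 2 * f' (- t) * f''' (- t) - 3 * (- f'' (- t))\<^sup>2 \<le> C * (f' (- t))\<^sup>2"
      using C[of "- t" for t] by (intro exI[of _ C]) simp
  qed
qed

section \<open>Critical circle maps\<close>

lemma deriv_shift: "deriv (\<lambda>t. f (x + t)) t = deriv f (x + t)" for f :: "real \<Rightarrow> real"
  unfolding deriv_def using DERIV_shift[of f _ t x] by (simp add: add.commute)

lemma real_analytic_deriv:
  assumes "real_analytic f"
  shows "real_analytic (deriv f)" and "(f has_real_derivative deriv f x) (at x)"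
proof -
  show "real_analytic (deriv f)"
    unfolding real_analytic_def
  proof
    fix x
    obtain P where "(\<lambda>t. f (x + t)) has_fps_expansion P"
      using assms unfolding real_analytic_def by blast
    from has_fps_expansion_deriv[OF this]
    have "(\<lambda>t. deriv f (x + t)) has_fps_expansion fps_deriv P"
      by (simp add: deriv_shift[abs_def])
    thus "\<exists>P. (\<lambda>t. deriv f (x + t)) has_fps_expansion P" by blast
  qed
  obtain P where P: "fps_conv_radius P > 0" "eventually (\<lambda>t. eval_fps P t = f (x + t)) (nhds 0)"
    using assms unfolding real_analytic_def has_fps_expansion_def by blast
  have "(eval_fps P has_real_derivative eval_fps (fps_deriv P) 0) (at 0)"
    using P(1) by (intro has_field_derivative_eval_fps) (simp add: zero_ereal_def)
  hence "((\<lambda>t. f (x + t)) has_real_derivative eval_fps (fps_deriv P) 0) (at 0)"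
    using P(2) by (subst (asm) DERIV_cong_ev[OF refl P(2) refl])
  hence "(f has_real_derivative eval_fps (fps_deriv P) 0) (at x)"
    using DERIV_shift[of f _ 0 x] by (simp add: add.commute)
  thus "(f has_real_derivative deriv f x) (at x)" by (simp add: DERIV_imp_deriv)
qed

lemma real_analytic_isCont: "real_analytic f \<Longrightarrow> isCont f x"
  using real_analytic_deriv(2) DERIV_isCont by blast

text \<open>Write \<open>g t = t\<^sup>e v t\<close> with \<open>v 0 \<noteq> 0\<close> and \<open>e\<close> even. After division by \<open>t\<^sup>2\<^sup>e\<^sup>-\<^sup>2\<close>, the left-hand side is a
  continuous function with value \<open>-(e\<^sup>2 + 2e) (v 0)\<^sup>2\<close> at \<open>0\<close>, and the right-hand side is \<open>-3 (v t)\<^sup>2\<close>.\<close>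
lemma schwarzian_near_even_zero:
  fixes g g' g'' :: "real \<Rightarrow> real"
  assumes an: "real_analytic g" and zero: "g 0 = 0"
    and pos: "\<And>t. \<lbrakk>0 < \<bar>t\<bar>; \<bar>t\<bar> < 1\<rbrakk> \<Longrightarrow> g t > 0"
  defines "g' \<equiv> deriv g" and "g'' \<equiv> deriv (deriv g)"
  shows "\<exists>\<delta>>0. \<forall>t. 0 < \<bar>t\<bar> \<and> \<bar>t\<bar> < \<delta> \<longrightarrow> 2 * g t * g'' t - 3 * (g' t)\<^sup>2 \<le> - 3 / t\<^sup>2 * (g t)\<^sup>2"
proof -
  obtain P where P: "fps_conv_radius P > 0" "eventually (\<lambda>t. eval_fps P t = g t) (nhds 0)"
    using an[unfolded real_analytic_def, rule_format, of 0] unfolding has_fps_expansion_def by auto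
  define e where "e = subdegree P"
  define Q where "Q = fps_shift e P"
  define v where "v = eval_fps Q"
  define v' where "v' = eval_fps (fps_deriv Q)"
  define v'' where "v'' = eval_fps (fps_deriv (fps_deriv Q))"
  have rQ: "fps_conv_radius Q = fps_conv_radius P" by (simp add: Q_def)
  have "eventually (\<lambda>t. t \<in> eball 0 (fps_conv_radius P)) (nhds (0::real))"
    using P(1) by (intro eventually_nhds_in_open) (auto simp: zero_ereal_def)
  with P(2) have "eventually (\<lambda>t. eval_fps P t = g t \<and> ereal (norm t) < fps_conv_radius P) (nhds 0)"
    by eventually_elim (auto simp: in_eball_iff)
  then obtain r where r: "r > 0" "\<And>t. \<bar>t\<bar> < r \<Longrightarrow> eval_fps P t = g t \<and> ereal (norm t) < fps_conv_radius P"
    unfolding eventually_nhds_metric dist_real_def by auto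
  have P0: "fps_nth P 0 = 0" using r(2)[of 0] r(1) zero by (simp add: eval_fps_at_0)
  have "P \<noteq> 0"
  proof
    assume "P = 0"
    define t where "t = min r 1 / 2"
    have t: "0 < t" "t < r" "t < 1" using r(1) by (auto simp: t_def min_def)
    have "g t = 0" using r(2)[of t] t \<open>P = 0\<close> by simp
    thus False using pos[of t] t by simp
  qed
  hence Q0: "v 0 \<noteq> 0" by (simp add: v_def Q_def e_def eval_fps_at_0)
  have e0: "e \<noteq> 0" using nth_subdegree_nonzero[OF \<open>P \<noteq> 0\<close>] P0 unfolding e_def by metis
  have gv: "g t = t ^ e * v t" if "\<bar>t\<bar> < r" for t
  proof -
    have "eval_fps P t = t ^ e * v t"
    proof (cases "t = 0")
      case True
      thus ?thesis using True P0 e0 by (simp add: eval_fps_at_0)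
    next
      case False
      thus ?thesis unfolding v_def Q_def using r(2)[OF that] by (subst eval_fps_shift) (auto simp: e_def)
    qed
    thus ?thesis using r(2)[OF that] by simp
  qed
  have dv: "(v has_real_derivative v' t) (at t)" "(v' has_real_derivative v'' t) (at t)" if "\<bar>t\<bar> < r" for t
  proof -
    have R: "ereal (norm t) < fps_conv_radius Q" using r(2)[OF that] rQ by simp
    moreover have "fps_conv_radius Q \<le> fps_conv_radius (fps_deriv Q)" by (rule fps_conv_radius_deriv)
    ultimately have "ereal (norm t) < fps_conv_radius (fps_deriv Q)" by (rule order_less_le_trans)
    thus "(v has_real_derivative v' t) (at t)" "(v' has_real_derivative v'' t) (at t)"
      unfolding v_def v'_def v''_def using R by (auto intro!: has_field_derivative_eval_fps)
  qed
  have cont: "isCont v 0" "isCont v' 0" using dv[of 0] r(1) by (auto intro: DERIV_isCont)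
  have cont'': "isCont v'' 0"
  proof -
    have "0 < fps_conv_radius Q" using P(1) rQ by simp
    also have "\<dots> \<le> fps_conv_radius (fps_deriv Q)" by (rule fps_conv_radius_deriv)
    also have "\<dots> \<le> fps_conv_radius (fps_deriv (fps_deriv Q))" by (rule fps_conv_radius_deriv)
    finally show ?thesis unfolding v''_def by (intro continuous_eval_fps) (simp add: zero_ereal_def)
  qed
  have sign: "\<exists>t. 0 < t * s \<and> \<bar>t\<bar> < r \<and> \<bar>t\<bar> < 1 \<and> v t * v 0 > 0" if "\<bar>s\<bar> = 1" for s
  proof -
    have "eventually (\<lambda>t. v t * v 0 > 0) (nhds 0)"
      using cont(1) Q0 by (intro order_tendstoD[of _ "v 0 * v 0"] tendsto_intros) (auto simp: isCont_def tendsto_at_iff_tendsto_nhds power2_eq_square[symmetric])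
    then obtain d where d: "d > 0" "\<And>t. \<bar>t\<bar> < d \<Longrightarrow> v t * v 0 > 0"
      unfolding eventually_nhds_metric dist_real_def by auto
    define t where "t = s * (min d (min r 1) / 2)"
    have "\<bar>t\<bar> = min d (min r 1) / 2" using that d(1) r(1) by (simp add: t_def abs_mult)
    moreover have "t * s = min d (min r 1) / 2"
      using that by (simp add: t_def) (metis abs_mult_self_eq mult.assoc mult.commute mult_1 times_divide_eq_right)
    ultimately show ?thesis using d r(1) by (intro exI[of _ t]) (auto simp: min_def split: if_splits)
  qed
  \<comment> \<open>A zero of odd order would make \<open>g\<close> change sign at 0.\<close>
  have "even e"
  proof (rule ccontr)
    assume "odd e"
    obtain t where t: "0 < t" "\<bar>t\<bar> < r" "\<bar>t\<bar> < 1" "v t * v 0 > 0" using sign[of 1] by auto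
    obtain u where u: "u < 0" "\<bar>u\<bar> < r" "\<bar>u\<bar> < 1" "v u * v 0 > 0" using sign[of "-1"] by auto
    have "t ^ e * v t > 0" "u ^ e * v u > 0" using pos[of t] pos[of u] gv t u by auto
    hence "v t > 0" "v u < 0" using t(1) u(1) \<open>odd e\<close> by (auto simp: zero_less_mult_iff zero_less_power_eq)
    thus False using t(4) u(4) by (auto simp: zero_less_mult_iff)
  qed
  with e0 obtain k where k: "e = Suc (Suc k)" by (metis One_nat_def not0_implies_Suc odd_one)
  define c :: real where "c = real e"
  have c: "c \<ge> 2" by (simp add: c_def k)
  have near: "eventually (\<lambda>s. \<bar>s\<bar> < r) (nhds t)" if "\<bar>t\<bar> < r" for t :: real
  proof -
    have "t \<in> {-r<..<r}" using that by auto
    hence "eventually (\<lambda>s. s \<in> {-r<..<r}) (nhds t)" by (intro eventually_nhds_in_open) auto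
    thus ?thesis by eventually_elim auto
  qed
  have g': "g' t = t ^ Suc k * (c * v t + t * v' t)" if t: "\<bar>t\<bar> < r" for t
  proof -
    have "((\<lambda>t. t ^ e * v t) has_real_derivative t ^ Suc k * (c * v t + t * v' t)) (at t)"
      using DERIV_mult[OF DERIV_pow[of e t UNIV] dv(1)[OF t]] by (simp add: k c_def algebra_simps)
    moreover have "eventually (\<lambda>s. s ^ e * v s = g s) (nhds t)"
      using near[OF t] by eventually_elim (simp add: gv)
    ultimately have "(g has_real_derivative t ^ Suc k * (c * v t + t * v' t)) (at t)"
      by (subst (asm) DERIV_cong_ev[OF refl _ refl])
    thus ?thesis unfolding g'_def by (rule DERIV_imp_deriv)
  qed
  have g'': "g'' t = t ^ k * (c * (c - 1) * v t + 2 * c * t * v' t + t\<^sup>2 * v'' t)" if t: "\<bar>t\<bar> < r" for t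
  proof -
    have "((\<lambda>t. t ^ Suc k * (c * v t + t * v' t)) has_real_derivative
        t ^ k * (c * (c - 1) * v t + 2 * c * t * v' t + t\<^sup>2 * v'' t)) (at t)"
    proof -
      have "((\<lambda>t. c * v t + t * v' t) has_real_derivative (c + 1) * v' t + t * v'' t) (at t)"
        by (auto intro!: derivative_eq_intros dv[OF t] simp: algebra_simps)
      from DERIV_mult[OF DERIV_pow[of "Suc k" t UNIV] this] show ?thesis
        by (simp add: k c_def algebra_simps power2_eq_square)
    qed
    moreover have "eventually (\<lambda>s. s ^ Suc k * (c * v s + s * v' s) = g' s) (nhds t)"
      using near[OF t] by eventually_elim (simp add: g')
    ultimately have "(g' has_real_derivative t ^ k * (c * (c - 1) * v t + 2 * c * t * v' t + t\<^sup>2 * v'' t)) (at t)"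
      by (subst (asm) DERIV_cong_ev[OF refl _ refl])
    thus ?thesis unfolding g''_def g'_def by (rule DERIV_imp_deriv)
  qed
  \<comment> \<open>The difference of the two sides divided by \<open>t^(2 e - 2)\<close>. It is
    negative at 0 because \<open>e \<ge> 2\<close>, hence negative nearby by continuity.\<close>
  define E where "E t = 2 * v t * (c * (c - 1) * v t + 2 * c * t * v' t + t\<^sup>2 * v'' t)
      - 3 * (c * v t + t * v' t)\<^sup>2 + 3 * (v t)\<^sup>2" for t
  have "E 0 = (v 0)\<^sup>2 * (3 - c\<^sup>2 - 2 * c)" by (simp add: E_def algebra_simps power2_eq_square)
  moreover have "3 - c\<^sup>2 - 2 * c < 0" using c by (smt (verit) zero_le_power2)
  ultimately have "E 0 < 0" using Q0 by (simp add: mult_pos_neg)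
  moreover have "isCont E 0" unfolding E_def by (intro continuous_intros cont cont'')
  ultimately have "eventually (\<lambda>t. E t < 0) (nhds 0)"
    by (intro order_tendstoD[of _ "E 0"]) (simp_all add: isCont_def tendsto_at_iff_tendsto_nhds)
  then obtain d where d: "d > 0" "\<And>t. \<bar>t\<bar> < d \<Longrightarrow> E t < 0"
    unfolding eventually_nhds_metric dist_real_def by auto
  show ?thesis
  proof (intro exI[of _ "min d r"] conjI allI impI)
    show "0 < min d r" using d(1) r(1) by simp
    fix t :: real assume t: "0 < \<bar>t\<bar> \<and> \<bar>t\<bar> < min d r"
    hence tr: "\<bar>t\<bar> < r" and td: "\<bar>t\<bar> < d" by auto
    have "2 * g t * g'' t - 3 * (g' t)\<^sup>2 + 3 / t\<^sup>2 * (g t)\<^sup>2 = (t ^ Suc k)\<^sup>2 * E t"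
      using t unfolding gv[OF tr] g'[OF tr] g''[OF tr] E_def k
      by (simp add: field_simps power2_eq_square)
    also have "\<dots> \<le> 0" using d(2)[OF td] by (intro mult_nonneg_nonpos) auto
    finally show "2 * g t * g'' t - 3 * (g' t)\<^sup>2 \<le> - 3 / t\<^sup>2 * (g t)\<^sup>2" by simp
  qed
qed

text \<open>The difference of two lifts is continuous and integer-valued.\<close>

lemma circle_lift_unique:
  assumes "circle_lift F f" "circle_lift F g"
  shows "\<exists>c. \<forall>x. f x = g x + c"
proof -
  have int: "f x - g x \<in> \<int>" for x
  proof -
    have "cis (2 * pi * f x) = cis (2 * pi * g x)" using assms by (simp add: circle_lift_def)
    then obtain n :: int where "2 * pi * f x = 2 * pi * g x + 2 * pi * of_int n"
      using sin_cos_eq_iff[of "2 * pi * f x" "2 * pi * g x"] by (auto simp: complex_eq_iff)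
    hence "2 * pi * (f x - g x) = 2 * pi * of_int n" by (simp add: algebra_simps)
    hence "f x - g x = of_int n" by simp
    thus ?thesis by simp
  qed
  have "continuous_on UNIV f" "continuous_on UNIV g"
    using assms by (auto simp: circle_lift_def incr_homeo_def homeomorphism_def)
  hence "(\<lambda>x. f x - g x) constant_on UNIV"
  proof (intro continuous_discrete_range_constant continuous_intros)
    fix x
    show "\<exists>e>0. \<forall>y. y \<in> UNIV \<and> f y - g y \<noteq> f x - g x \<longrightarrow> e \<le> norm (f y - g y - (f x - g x))"
    proof (intro exI[of _ 1] conjI allI impI)
      fix y assume y: "y \<in> UNIV \<and> f y - g y \<noteq> f x - g x"
      have "f y - g y - (f x - g x) \<in> \<int>" using int[of x] int[of y] by (rule Ints_diff[rotated])
      thus "1 \<le> norm (f y - g y - (f x - g x))" using Ints_nonzero_abs_ge1[of "f y - g y - (f x - g x)"] y by simp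
    qed simp
  qed auto
  then obtain c where "\<And>x. f x - g x = c" unfolding constant_on_def by auto
  thus ?thesis by (intro exI[of _ c]) (simp add: algebra_simps)
qed

lemma cis_eq_1_iff_Ints: "cis (2 * pi * x) = 1 \<longleftrightarrow> x \<in> \<int>"
proof
  assume "cis (2 * pi * x) = 1"
  then obtain n :: int where "2 * pi * x = 0 + 2 * pi * of_int n"
    using sin_cos_eq_iff[of "2 * pi * x" 0] by (auto simp: complex_eq_iff)
  thus "x \<in> \<int>" by simp
next
  assume "x \<in> \<int>"
  thus "cis (2 * pi * x) = 1" by (auto elim!: Ints_cases)
qed

text \<open>The lift \<open>f\<close> differs by a constant from the analytic lift
  \<open>f0\<close>, so it has the same derivatives and critical points. Being positive off the
  integers, \<open>f'\<close> has a zero of even order at 0, which gives the estimate there.\<close>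

lemma critical_lift_of_circle_map:
  assumes F: "critical_circle_map F" and f: "circle_lift F f" and h: "normalized_linearization f \<theta> h"
  shows "critical_lift f (deriv f) (deriv (deriv f)) (deriv (deriv (deriv f))) h \<theta>"
proof -
  obtain f0 where f0: "circle_lift F f0" "real_analytic f0"
    "{cis (2 * pi * x) | x. (f0 has_real_derivative 0) (at x)} = {1}"
    using F unfolding critical_circle_map_def by blast
  obtain c where c: "\<And>x. f x = f0 x + c" using circle_lift_unique[OF f f0(1)] by blast
  have an: "real_analytic f"
    unfolding real_analytic_def
  proof
    fix x
    obtain P where "(\<lambda>t. f0 (x + t)) has_fps_expansion P" using f0(2) unfolding real_analytic_def by blast
    hence "(\<lambda>t. f0 (x + t) + c) has_fps_expansion P + fps_const c"
      by (intro has_fps_expansion_add) auto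
    thus "\<exists>P. (\<lambda>t. f (x + t)) has_fps_expansion P" by (auto simp: c)
  qed
  note d1 = real_analytic_deriv[OF an]
  note d2 = real_analytic_deriv[OF d1(1)]
  note d3 = real_analytic_deriv[OF d2(1)]
  have f0_deriv: "(f0 has_real_derivative deriv f x) (at x)" for x
    using DERIV_diff[OF d1(2)[of x] DERIV_const[of c]] by (simp add: c)
  have hm: "strict_mono h" and hs: "surj h" and h0: "h 0 = 0" and hp: "h (x + 1) = h x + 1"
    and hc: "h (f x) = h x + \<theta>" for x
    using h by (auto simp: normalized_linearization_def incr_homeo_def homeomorphism_def)
  \<comment> \<open>Both sides have the same image under the injective map \<open>h\<close>.\<close>
  have per: "f (x + 1) = f x + 1" for x
  proof -
    have "h (f (x + 1)) = h (f x + 1)" by (simp add: hp hc)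
    thus ?thesis using strict_mono_eq[OF hm] by blast
  qed
  have dper: "deriv g (x + 1) = deriv g x" if "\<And>x. g (x + 1) = g x + b" "real_analytic g"
    for g :: "real \<Rightarrow> real" and b x
  proof -
    have "((\<lambda>x. g (x + 1)) has_real_derivative deriv g (x + 1)) (at x)"
      using real_analytic_deriv(2)[OF that(2), of "x + 1"] by (simp add: DERIV_shift)
    moreover have "((\<lambda>x. g x + b) has_real_derivative deriv g x) (at x)"
      using DERIV_add[OF real_analytic_deriv(2)[OF that(2), of x] DERIV_const[of b]] by simp
    ultimately show ?thesis unfolding that(1) by (rule DERIV_unique)
  qed
  have per1: "deriv f (x + 1) = deriv f x" for x using dper[OF per an] .
  have per2: "deriv (deriv f) (x + 1) = deriv (deriv f) x" for x using dper[of "deriv f" 0] per1 d1(1) by simp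
  have per3: "deriv (deriv (deriv f)) (x + 1) = deriv (deriv (deriv f)) x" for x
    using dper[of "deriv (deriv f)" 0] per2 d2(1) by simp
  have per_int: "g (x + of_int n) = g x" if "\<And>x. g (x + 1) = g x" for g :: "real \<Rightarrow> real" and x n
  proof -
    have nat: "g (x + of_nat k) = g x" for x k
    proof (induction k)
      case (Suc k)
      show ?case using that[of "x + of_nat k"] Suc by (simp add: algebra_simps)
    qed simp
    show ?thesis
    proof (cases "n \<ge> 0")
      case True
      thus ?thesis using nat[of x "nat n"] by simp
    next
      case False
      thus ?thesis using nat[of "x + of_int n" "nat (- n)"] by simp
    qed
  qed
  have fm: "f x < f y" if "x < y" for x y
    using that f by (simp add: circle_lift_def incr_homeo_def strict_monoD)
  have nonneg: "deriv f x \<ge> 0" for x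
  proof (rule ccontr)
    assume "\<not> deriv f x \<ge> 0"
    then obtain e where e: "e > 0" "\<And>t. \<lbrakk>t > 0; t < e\<rbrakk> \<Longrightarrow> f (x + t) < f x"
      using DERIV_neg_dec_right[OF d1(2)[of x]] by auto
    have "f (x + e / 2) < f x" using e by (intro e(2)) auto
    moreover have "f x < f (x + e / 2)" using e(1) by (intro fm) simp
    ultimately show False by simp
  qed
  have pos: "deriv f x > 0" if "x \<notin> \<int>" for x
  proof -
    have "deriv f x \<noteq> 0"
    proof
      assume "deriv f x = 0"
      hence "cis (2 * pi * x) \<in> {1}" using f0_deriv[of x] unfolding f0(3)[symmetric] by auto
      thus False using that cis_eq_1_iff_Ints by simp
    qed
    thus ?thesis using nonneg[of x] by simp
  qed
  have zero: "deriv f 0 = 0"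
  proof -
    have "1 \<in> {cis (2 * pi * x) | x. (f0 has_real_derivative 0) (at x)}" unfolding f0(3) by simp
    then obtain x where x: "cis (2 * pi * x) = 1" "(f0 has_real_derivative 0) (at x)" by auto
    have "deriv f x = 0" using DERIV_unique[OF f0_deriv x(2)] .
    moreover obtain n where "x = of_int n" using x(1) cis_eq_1_iff_Ints by (auto elim: Ints_cases)
    ultimately show ?thesis using per_int[of "deriv f" 0 n] per1 by simp
  qed
  have not_int: "t \<notin> \<int>" if "0 < \<bar>t\<bar>" "\<bar>t\<bar> < 1" for t :: real
    using that by (auto elim!: Ints_cases)
  obtain \<delta> where \<delta>: "\<delta> > 0" "\<And>t. \<lbrakk>0 < \<bar>t\<bar>; \<bar>t\<bar> < \<delta>\<rbrakk> \<Longrightarrow>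
      2 * deriv f t * deriv (deriv (deriv f)) t - 3 * (deriv (deriv f) t)\<^sup>2 \<le> - 3 / t\<^sup>2 * (deriv f t)\<^sup>2"
    using schwarzian_near_even_zero[OF d1(1) zero] pos not_int by blast
  \<comment> \<open>Within \<open>\<delta>\<close> of an integer the local estimate makes the
    Schwarzian derivative negative; the rest of a period is compact and free of critical
    points.\<close>
  have bdd: "\<exists>C. \<forall>t. t \<notin> \<int> \<longrightarrow>
     2 * deriv f t * deriv (deriv (deriv f)) t - 3 * (deriv (deriv f) t)\<^sup>2 \<le> C * (deriv f t)\<^sup>2"
  proof -
    define N where "N t = 2 * deriv f t * deriv (deriv (deriv f)) t - 3 * (deriv (deriv f) t)\<^sup>2" for t
    define I where "I = {min \<delta> (1/2) .. 1 - min \<delta> (1/2)}"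
    have Iint: "t \<notin> \<int>" if "t \<in> I" for t
    proof (rule not_int)
      have "0 < min \<delta> (1/2)" using \<delta>(1) by simp
      thus "0 < \<bar>t\<bar>" "\<bar>t\<bar> < 1" using that unfolding I_def atLeastAtMost_iff by linarith+
    qed
    have "continuous_on I (\<lambda>t. N t / (deriv f t)\<^sup>2)"
      unfolding N_def using pos Iint
      by (intro continuous_intros continuous_at_imp_continuous_on ballI
           real_analytic_isCont d1(1) d2(1) d3(1)) (metis less_irrefl power_eq_0_iff zero_power2)+
    hence "bounded ((\<lambda>t. N t / (deriv f t)\<^sup>2) ` I)"
      by (intro compact_imp_bounded compact_continuous_image) (auto simp: I_def)
    then obtain B where B: "\<And>t. t \<in> I \<Longrightarrow> \<bar>N t / (deriv f t)\<^sup>2\<bar> \<le> B"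
      unfolding bounded_iff by auto
    define C where "C = max B 0"
    have near: "N t \<le> C * (deriv f t)\<^sup>2" if "0 < \<bar>t\<bar>" "\<bar>t\<bar> < \<delta>" for t
    proof -
      have "N t \<le> - 3 / t\<^sup>2 * (deriv f t)\<^sup>2" using \<delta>(2)[OF that] by (simp add: N_def)
      also have "\<dots> \<le> C * (deriv f t)\<^sup>2"
        by (intro mult_right_mono) (auto simp: C_def intro: order_trans[of _ 0])
      finally show ?thesis .
    qed
    have "N t \<le> C * (deriv f t)\<^sup>2" if t: "t \<notin> \<int>" for t
    proof -
      define s where "s = frac t"
      have s: "0 < s" "s < 1" using t by (simp_all add: s_def frac_lt_1)
      have shift: "N (u + of_int n) = N u \<and> deriv f (u + of_int n) = deriv f u" for u n
        using per_int[of "deriv f"] per_int[of "deriv (deriv f)"] per_int[of "deriv (deriv (deriv f))"] per1 per2 per3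
        by (simp add: N_def)
      have "N s \<le> C * (deriv f s)\<^sup>2"
      proof -
        consider "s < \<delta>" | "1 - s < \<delta>" | "s \<in> I" by (fastforce simp: I_def min_def)
        thus ?thesis
        proof cases
          case 1
          thus ?thesis using near[of s] s by simp
        next
          case 2
          thus ?thesis using near[of "s - 1"] s shift[of s "-1"] by simp
        next
          case 3
          hence "N s / (deriv f s)\<^sup>2 \<le> C" using B[OF 3] unfolding C_def by linarith
          thus ?thesis using pos[OF Iint[OF 3]] by (simp add: pos_divide_le_eq)
        qed
      qed
      thus ?thesis using shift[of s "\<lfloor>t\<rfloor>"] by (simp add: s_def frac_def)
    qed
    thus ?thesis unfolding N_def by blast
  qed
  show ?thesis
    by unfold_locales (use hm hs h0 hp hc d1(2) d2(2) d3(2) pos \<delta> bdd in blast)+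
qed

section \<open>The piecewise affine interpolants\<close>

lemma pair_bound_reflect:
  assumes "pair_bound g K"
  shows "pair_bound (\<lambda>x. - g (- x)) K"
  unfolding pair_bound_def
proof (intro allI impI)
  fix x t :: real assume "0 < t"
  hence *: "g (- x + t) - g (- x) \<le> K * (g (- x) - g (- x - t))"
    "g (- x) - g (- x - t) \<le> K * (g (- x + t) - g (- x))"
    using assms unfolding pair_bound_def by blast+
  have "- (x + t) = - x - t" "- (x - t) = - x + t" by simp_all
  thus "- g (- (x + t)) - - g (- x) \<le> K * (- g (- x) - - g (- (x - t))) \<and>
      - g (- x) - - g (- (x - t)) \<le> K * (- g (- (x + t)) - - g (- x))"
    using * by (simp only: minus_diff_minus minus_diff_eq)
qed

lemma pair_bound_of_ratio:
  assumes "mono g" and K: "K \<ge> 1" and r: "\<And>x t. 0 < t \<Longrightarrow>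
      1 / K \<le> (g (x + t) - g x) / (g x - g (x - t)) \<and> (g (x + t) - g x) / (g x - g (x - t)) \<le> K"
  shows "pair_bound g K"
  unfolding pair_bound_def
proof (intro allI impI)
  fix x t :: real assume t: "0 < t"
  have nn: "g x - g (x - t) \<ge> 0" using monoD[OF assms(1), of "x - t" x] t by simp
  \<comment> \<open>If the denominator were \<open>0\<close>, the quotient would be \<open>0 < 1/K\<close>.\<close>
  have "g x - g (x - t) \<noteq> 0" using r[OF t, of x] K by auto
  hence p: "g x - g (x - t) > 0" using nn by simp
  have "g (x + t) - g x \<le> K * (g x - g (x - t))" using r[OF t, of x] p by (simp add: pos_divide_le_eq)
  moreover have "1 / K * (g x - g (x - t)) \<le> g (x + t) - g x"
    using r[OF t, of x] p by (simp only: pos_le_divide_eq)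
  hence "g x - g (x - t) \<le> K * (g (x + t) - g x)" using K by (simp add: field_simps)
  ultimately show "g (x + t) - g x \<le> K * (g x - g (x - t)) \<and> g x - g (x - t) \<le> K * (g (x + t) - g x)"
    by simp
qed

text \<open>The nodes are locally finite and unbounded in both directions, so every point lies
  between two adjacent nodes, where the slope is positive because \<open>h\<close>
  increases.\<close>

lemma mono_pw_affine_interpolant:
  fixes X :: "nat \<Rightarrow> real"
  assumes Q: "Q = {X j + of_int m | j m. j < N}" and N: "N \<ge> 1"
    and h: "strict_mono h" and g: "pw_affine_interpolant Q h g"
  shows "mono g"
proof -
  have fin: "finite (Q \<inter> {u..v})" for u v
  proof -
    have "Q \<inter> {u..v} \<subseteq> (\<Union>j<N. (\<lambda>m. X j + of_int m) ` {\<lfloor>u - X j\<rfloor>..\<lceil>v - X j\<rceil>})"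
    proof
      fix z assume "z \<in> Q \<inter> {u..v}"
      then obtain j m where z: "z = X j + of_int m" "j < N" "u \<le> z" "z \<le> v" by (auto simp: Q)
      hence "\<lfloor>u - X j\<rfloor> \<le> m" "m \<le> \<lceil>v - X j\<rceil>" by linarith+
      thus "z \<in> (\<Union>j<N. (\<lambda>m. X j + of_int m) ` {\<lfloor>u - X j\<rfloor>..\<lceil>v - X j\<rceil>})"
        unfolding z(1) using z(2) by (intro UN_I[of j] imageI) auto
    qed
    thus ?thesis by (rule finite_subset) auto
  qed
  have adj: "\<exists>u\<in>Q. \<exists>v\<in>Q. u \<le> x \<and> x < v \<and> {u<..<v} \<inter> Q = {}" for x
  proof -
    have Q0: "X 0 + of_int m \<in> Q" for m using N by (auto simp: Q)
    \<comment> \<open>Windows of length 1 suffice, since the integer translates of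
      \<open>X 0\<close> are nodes.\<close>
    define U where "U = Q \<inter> {x - 1..x}"
    define V where "V = Q \<inter> {x<..x + 1}"
    have "X 0 + of_int \<lfloor>x - X 0\<rfloor> \<in> U" "X 0 + of_int (\<lfloor>x - X 0\<rfloor> + 1) \<in> V"
      using Q0[of "\<lfloor>x - X 0\<rfloor>"] Q0[of "\<lfloor>x - X 0\<rfloor> + 1"] unfolding U_def V_def
        Int_iff atLeastAtMost_iff greaterThanAtMost_iff by (safe; linarith)+
    moreover have "U \<subseteq> Q \<inter> {x - 1..x + 1}" "V \<subseteq> Q \<inter> {x - 1..x + 1}" by (auto simp: U_def V_def)
    hence "finite U" "finite V" using fin finite_subset by blast+
    ultimately have U: "Max U \<in> U" "\<And>z. z \<in> U \<Longrightarrow> z \<le> Max U" and V: "Min V \<in> V" "\<And>z. z \<in> V \<Longrightarrow> Min V \<le> z"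
      by (auto intro: Max_in Min_in)
    have mem: "\<And>z. z \<in> U \<Longrightarrow> z \<in> Q \<and> z \<le> x" "\<And>z. z \<in> V \<Longrightarrow> z \<in> Q \<and> x < z"
      by (auto simp: U_def V_def)
    have "{Max U<..<Min V} \<inter> Q = {}"
    proof (rule ccontr)
      assume "{Max U<..<Min V} \<inter> Q \<noteq> {}"
      then obtain z where z: "z \<in> Q" "Max U < z" "z < Min V" by auto
      show False
      proof (cases "z \<le> x")
        case True
        hence "z \<in> U" using z U(1) by (auto simp: U_def)
        thus False using U(2)[of z] z by simp
      next
        case False
        hence "z \<in> V" using z V(1) by (auto simp: V_def)
        thus False using V(2)[of z] z by simp
      qed
    qed
    thus ?thesis using mem(1)[OF U(1)] mem(2)[OF V(1)] by blast
  qed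
  have aff: "g s \<le> g t" if uv: "u \<in> Q" "v \<in> Q" "{u<..<v} \<inter> Q = {}" and st: "u \<le> s" "s \<le> t" "t \<le> v" for u v s t
  proof (cases "u < v")
    case True
    then obtain c d where cd: "\<And>z. z \<in> {u..v} \<Longrightarrow> g z = c * z + d"
      using g uv unfolding pw_affine_interpolant_def by blast
    have "g u < g v" using g uv True h by (simp add: pw_affine_interpolant_def strict_monoD)
    hence "c * u < c * v" using cd[of u] cd[of v] True by simp
    hence "c > 0" using True by (simp add: mult_less_cancel_left)
    thus ?thesis using cd[of s] cd[of t] st by simp
  next
    case False
    hence "s = t" using st by simp
    thus ?thesis by simp
  qed
  show ?thesis
  proof (rule monoI)
    fix x y :: real assume "x \<le> y"
    obtain u v where uv: "u \<in> Q" "v \<in> Q" "u \<le> x" "x < v" "{u<..<v} \<inter> Q = {}" using adj[of x] by blast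
    obtain u' v' where uv': "u' \<in> Q" "v' \<in> Q" "u' \<le> y" "y < v'" "{u'<..<v'} \<inter> Q = {}" using adj[of y] by blast
    show "g x \<le> g y"
    proof (cases "y \<le> v")
      case True
      thus ?thesis using aff[OF uv(1,2,5)] uv \<open>x \<le> y\<close> by simp
    next
      case False
      have "v \<notin> {u'<..<v'}" using uv'(5) uv(2) by blast
      hence "v \<le> u'" using False uv'(4) by simp
      have "g x \<le> g v" using aff[OF uv(1,2,5)] uv by simp
      also have "g v \<le> g u'"
        using g uv(2) uv'(1) \<open>v \<le> u'\<close> h by (simp add: pw_affine_interpolant_def strict_mono_less_eq)
      also have "g u' \<le> g y" using aff[OF uv'(1,2,5)] uv' by simp
      finally show ?thesis .
    qed
  qed
qed

text \<open>A bound for every admissible \<open>K\<close> passes to the infimum; without any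
  admissible \<open>K\<close> the norm is infinite.\<close>

lemma le_ereal_mult_qs_norm:
  assumes "c > 0" and "\<And>K. \<lbrakk>1 \<le> K; \<And>x t. 0 < t \<Longrightarrow>
      1 / K \<le> (g (x + t) - g x) / (g x - g (x - t)) \<and> (g (x + t) - g x) / (g x - g (x - t)) \<le> K\<rbrakk> \<Longrightarrow> M \<le> c * K"
  shows "ereal M \<le> ereal c * qs_norm g"
proof -
  have "ereal (M / c) \<le> qs_norm g"
    unfolding qs_norm_def
  proof (rule INF_greatest)
    fix K assume "K \<in> {K. 1 \<le> K \<and> (\<forall>x t. 0 < t \<longrightarrow> 1 / K \<le> (g (x + t) - g x) / (g x - g (x - t)) \<and>
           (g (x + t) - g x) / (g x - g (x - t)) \<le> K)}"
    hence "M \<le> c * K" using assms(2)[of K] by blast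
    thus "ereal (M / c) \<le> ereal K" using assms(1) by (simp add: pos_divide_le_eq mult.commute)
  qed
  hence "ereal c * ereal (M / c) \<le> ereal c * qs_norm g"
    using assms(1) by (intro ereal_mult_left_mono) auto
  thus ?thesis using assms(1) by simp
qed

theorem proposition3p1:
  fixes F :: "complex \<Rightarrow> complex"
    and \<theta> :: real
    and a :: "nat \<Rightarrow> nat"
    and f h :: "real \<Rightarrow> real"
    and hn :: "nat \<Rightarrow> real \<Rightarrow> real"
  assumes "critical_circle_map F"
    and "\<theta> \<in> {0<..<1}" and "\<theta> \<notin> \<rat>"
    and "cf_expansion \<theta> a"
    and "lift_with_rotation_number F \<theta> f"
    and "normalized_linearization f \<theta> h"
    and "\<And>n. n \<ge> 1 \<Longrightarrow> pw_affine_interpolant (dyn_partition f a n) h (hn n)"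
  shows "\<exists>C::real. C \<ge> 1 \<and> (\<exists>n0::nat. n0 \<ge> 1 \<and>
           (\<forall>n\<ge>n0. ereal (real (Max (a ` {1..n}))) \<le> ereal C * qs_norm (hn n)))"
proof -
  have lift: "circle_lift F f" using assms(5) by (simp add: lift_with_rotation_number_def)
  have a1: "\<forall>m\<ge>1. a m \<ge> 1" and lim: "(\<lambda>n. real_of_rat (cf_convergent a n)) \<longlonglongrightarrow> \<theta>"
    using assms(4) by (auto simp: cf_expansion_def)
  have L: "critical_lift f (deriv f) (deriv (deriv f)) (deriv (deriv (deriv f))) h \<theta>"
    using critical_lift_of_circle_map[OF assms(1) lift assms(6)] .
  interpret L: critical_lift f "deriv f" "deriv (deriv f)" "deriv (deriv (deriv f))" h \<theta> by (rule L)
  \<comment> \<open>The sign of \<open>q \<theta> - p\<close> alternates with the index of the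
    convergent, so the bound is prepared on both sides of 0.\<close>
  obtain \<delta>1 where \<delta>1: "\<delta>1 > 0" and right: "return_bound h \<theta> \<delta>1"
    using L.ex_return_bound by blast
  obtain \<delta>2 where \<delta>2: "\<delta>2 > 0" and left: "return_bound (\<lambda>x. - h (- x)) (- \<theta>) \<delta>2"
    using critical_lift.ex_return_bound[OF critical_lift_reflect[OF L]] by blast
  have "0 < min \<delta>1 \<delta>2" using \<delta>1 \<delta>2 by simp
  then obtain m0 :: nat where m0: "1 / real (Suc m0) < min \<delta>1 \<delta>2" by (rule nat_approx_posE)
  have f_bij: "f (inv f x) = x" for x
    using lift homeomorphism_image1 unfolding circle_lift_def incr_homeo_def by (blast intro: surj_f_inv_f)
  have h_inv: "h ((inv f ^^ j) 0) = - real j * \<theta>" for j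
  proof (induction j)
    case (Suc j)
    have "h (f ((inv f ^^ Suc j) 0)) = h ((inv f ^^ j) 0)" by (simp add: f_bij)
    thus ?case using Suc by (simp add: L.h_conj algebra_simps)
  qed (simp add: L.h_0)
  have dyn: "dyn_partition f a n = {(inv f ^^ j) 0 + of_int m | j m. j < cf_q a n}" for n
    by (simp add: dyn_partition_def cf_denom_eq[OF a1])
  have main: "real (a m) \<le> 4 * (10^7 + 2) * K"
    if m: "m \<ge> m0 + 2" "m \<le> n" and K: "1 \<le> K" "\<And>x t. 0 < t \<Longrightarrow>
      1 / K \<le> (hn n (x + t) - hn n x) / (hn n x - hn n (x - t)) \<and>
      (hn n (x + t) - hn n x) / (hn n x - hn n (x - t)) \<le> K" for m n K
  proof -
    \<comment> \<open>With \<open>l = m - 2\<close> the return time is the denominator of index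
      \<open>m - 1\<close>. The recursion of the errors gives
      \<open>a m * d < cf_err a \<theta> l\<close>, from which both the smallness and the separation
      follow.\<close>
    obtain l where l: "m = Suc (Suc l)" "l \<ge> m0" using m(1) that[of "m - 2"] by simp
    define q where "q = cf_q a (Suc l)"
    define p where "p = int (cf_p a (Suc l))"
    define d where "d = cf_err a \<theta> (Suc l)"
    have pw: "pw_affine_interpolant (dyn_partition f a n) h (hn n)" using assms(7) m by simp
    have mono: "mono (hn n)"
      by (rule mono_pw_affine_interpolant[OF dyn cf_q_pos[OF a1] L.h_mono pw])
    have pair: "pair_bound (hn n) K" by (rule pair_bound_of_ratio[OF mono K])
    have d: "d > 0" unfolding d_def by (rule cf_err_pos[OF a1 lim])
    have q: "q \<ge> 1" unfolding q_def by (rule cf_q_pos[OF a1])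
    have A: "a m \<ge> 1" using a1 m(1) by simp
    have Ad: "real (a m) * d < cf_err a \<theta> l"
      using cf_err_rec[OF a1, of \<theta> l] cf_err_pos[OF a1 lim, of "Suc (Suc l)"] by (simp add: d_def l)
    have "1 / real (Suc l) \<le> 1 / real (Suc m0)" using l(2) by (simp add: frac_le)
    hence small: "real (a m) * d < \<delta>1" "real (a m) * d < \<delta>2"
      using Ad cf_err_le[OF a1 lim, of l] m0 by auto
    have sep: "real (a m) * d < \<bar>real_of_int j * \<theta> - real_of_int v\<bar>" if "0 < j" "j < int q" for j v
      using cf_best_approximation[OF a1 lim, of j l v] that Ad by (simp add: q_def)
    have err: "(- 1) ^ Suc l * (real q * \<theta> - real_of_int p) = d"
      by (simp add: d_def cf_err_def[OF a1] q_def p_def)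
    \<comment> \<open>Such a \<open>z\<close> is \<open>f^(-kq)(0) + k p\<close>. It is a node of
      level \<open>n\<close> because \<open>k q \<le> a_m q_(m-1) < q_m \<le> q_n\<close>, strictly
      since \<open>q_(m-2) \<ge> 1\<close>.\<close>
    have node: "hn n z = h z" if "k \<le> a m" "h z = real k * (real_of_int p - real q * \<theta>)" for k z
    proof -
      have "h ((inv f ^^ (k * q)) 0 + of_int (int k * p)) = h z"
        unfolding L.h_add_int h_inv that(2) by (simp add: algebra_simps)
      hence "z = (inv f ^^ (k * q)) 0 + of_int (int k * p)" by simp
      moreover have "k * q < cf_q a n"
      proof -
        have "k * q \<le> a m * q" using that(1) by simp
        also have "\<dots> < cf_q a m" using cf_q_pos[OF a1, of l] by (simp add: l q_def cf_pq_rec)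
        also have "\<dots> \<le> cf_q a n" by (rule cf_q_mono[OF a1 m(2)])
        finally show ?thesis .
      qed
      ultimately have "z \<in> dyn_partition f a n" unfolding dyn by blast
      thus ?thesis using pw by (simp add: pw_affine_interpolant_def)
    qed
    show ?thesis
    \<comment> \<open>For odd \<open>Suc l\<close> the backward orbit lies to the right of 0; for
      even \<open>Suc l\<close> it lies to the left, and the reflected bound applies with
      \<open>- p\<close>.\<close>
    proof (cases "even (Suc l)")
      case False
      hence e: "real_of_int p - real q * \<theta> = d" using err by simp
      show ?thesis
      proof (rule right[unfolded return_bound_def, rule_format, OF q d A _ sep small(1) mono _ K(1) pair])
        show "real q * \<theta> - real_of_int p = - d" using e by simp
        show "hn n z = real k * d" if "k \<le> a m" "h z = real k * d" for k z
          using node[of k z] that by (simp add: e)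
      qed
    next
      case True
      hence e: "real_of_int p - real q * \<theta> = - d" using err by simp
      show ?thesis
      proof (rule left[unfolded return_bound_def, rule_format, OF q d A _ _ small(2) _ _ K(1) pair_bound_reflect[OF pair]])
        show "real q * - \<theta> - real_of_int (- p) = - d" using e by simp
        show "real (a m) * d < \<bar>real_of_int j * - \<theta> - real_of_int v\<bar>" if "0 < j" "j < int q" for j v
          using sep[OF that, of "- v"] by (simp add: abs_minus_commute algebra_simps)
        show "mono (\<lambda>x. - hn n (- x))" using mono by (auto simp: mono_def)
        show "- hn n (- z) = real k * d" if "k \<le> a m" "- h (- z) = real k * d" for k z
          using node[of k "- z"] that by (simp add: e)
      qed
    qed
  qed
  \<comment> \<open>The finitely many partial quotients of index below \<open>m0 + 2\<close> are
    absorbed into \<open>C\<close>, since every admissible \<open>K\<close> is at least 1.\<close>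
  define C where "C = max (4 * (10^7 + 2)) (real (Max (a ` {1..m0 + 2})))"
  have C: "C \<ge> 1" "C \<ge> 4 * (10^7 + 2)" by (auto simp: C_def)
  have "ereal (real (Max (a ` {1..n}))) \<le> ereal C * qs_norm (hn n)" if n: "n \<ge> 1" for n
  proof (rule le_ereal_mult_qs_norm)
    show "C > 0" using C by simp
    fix K :: real assume K: "1 \<le> K" "\<And>x t. 0 < t \<Longrightarrow>
      1 / K \<le> (hn n (x + t) - hn n x) / (hn n x - hn n (x - t)) \<and>
      (hn n (x + t) - hn n x) / (hn n x - hn n (x - t)) \<le> K"
    have "Max (a ` {1..n}) \<in> a ` {1..n}" using n by (intro Max_in) auto
    then obtain m where m: "m \<in> {1..n}" "Max (a ` {1..n}) = a m" by auto
    have "real (a m) \<le> C * K"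
    proof (cases "m \<ge> m0 + 2")
      case True
      have "real (a m) \<le> 4 * (10^7 + 2) * K" using main[OF True _ K] m by simp
      also have "\<dots> \<le> C * K" using C K by (intro mult_right_mono) auto
      finally show ?thesis .
    next
      case False
      hence "a m \<le> Max (a ` {1..m0 + 2})" using m by (intro Max_ge) auto
      hence "real (a m) \<le> C * 1" by (simp add: C_def)
      also have "\<dots> \<le> C * K" using C K by (intro mult_left_mono) auto
      finally show ?thesis .
    qed
    thus "real (Max (a ` {1..n})) \<le> C * K" using m by simp
  qed
  thus ?thesis using C(1) by (intro exI[of _ C] conjI exI[of _ 1]) auto
qed

end
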